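(* A digraph admits an odd dijoin if and only if it has neither an odd diamond nor an odd one-direction as a cut minor.
   Context: Digraphs may have loops and parallel/antiparallel edges. A bond of a digraph $D$ is an inclusion-minimal nonempty cut $D[X,Y]$ (edges between the parts of a vertex partition $(X,Y)$); it is directed if no edge has tail in $Y$ and head in $X$. An odd dijoin is a set $J\subseteq E(D)$ with $|J\cap S|$ odd for every directed bond $S$. Contracting an edge set $A$ means deleting the edges of $A$ and identifying each weak component of $D[A]$ to a single vertex (contracting a loop deletes it). A non-loop edge $e=(x,y)$ is deletable if there is a directed $x$–$y$ path in $D$ not using $e$. A cut minor of $D$ is a digraph obtained by a finite sequence of edge contractions, deletions of deletable edges and deletions of isolated vertices. A diamond is a digraph with two vertices $h_1,h_2$ and vertices $x_1,\dots,x_n$, $n\ge 3$, where each $x_i$ has either exactly two outgoing edges, one to each of $h_1,h_2$, or exactly two incoming edges, one from each of $h_1,h_2$, and there are no other edges. A one-direction is a digraph isomorphic to $\vec{K}_{n_1,n_2}$ (complete bipartite graph with all edges oriented from the part of size $n_1$ to the part of size $n_2$) for some $n_1,n_2\ge 2$. A diamond or one-direction is odd if its number of vertices is odd. *)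

theory Defs
  imports "Graph_Theory.Graph_Theory"
begin

definition cut_between :: "('a, 'b) pre_digraph \<Rightarrow> 'a set \<Rightarrow> 'a set \<Rightarrow> 'b set" where
  "cut_between G X Y = {e \<in> arcs G.
     tail G e \<in> X \<and> head G e \<in> Y \<or> tail G e \<in> Y \<and> head G e \<in> X}"

definition vertex_bipartition :: "('a, 'b) pre_digraph \<Rightarrow> 'a set \<Rightarrow> 'a set \<Rightarrow> bool" where
  "vertex_bipartition G X Y \<longleftrightarrow> X \<union> Y = verts G \<and> X \<inter> Y = {}"

definition is_cut :: "('a, 'b) pre_digraph \<Rightarrow> 'b set \<Rightarrow> bool" where
  "is_cut G S \<longleftrightarrow> (\<exists>X Y. vertex_bipartition G X Y \<and> S = cut_between G X Y)"

definition bond :: "('a, 'b) pre_digraph \<Rightarrow> 'b set \<Rightarrow> bool" where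
  "bond G S \<longleftrightarrow> is_cut G S \<and> S \<noteq> {} \<and> (\<forall>T. is_cut G T \<and> T \<noteq> {} \<and> T \<subseteq> S \<longrightarrow> T = S)"

definition directed_bond :: "('a, 'b) pre_digraph \<Rightarrow> 'b set \<Rightarrow> bool" where
  "directed_bond G S \<longleftrightarrow> bond G S \<and>
     (\<exists>X Y. vertex_bipartition G X Y \<and> S = cut_between G X Y \<and>
        \<not> (\<exists>e \<in> arcs G. tail G e \<in> Y \<and> head G e \<in> X))"

definition odd_dijoin :: "('a, 'b) pre_digraph \<Rightarrow> 'b set \<Rightarrow> bool" where
  "odd_dijoin G J \<longleftrightarrow> J \<subseteq> arcs G \<and> (\<forall>S. directed_bond G S \<longrightarrow> odd (card (J \<inter> S)))"

text \<open>
  The weak component of \<open>v\<close> in the spanning subdigraph with arc set \<open>A\<close>;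
  it is \<open>{v}\<close> for a vertex \<open>v\<close> that is not incident with \<open>A\<close>.
\<close>

definition weak_component :: "('a, 'b) pre_digraph \<Rightarrow> 'b set \<Rightarrow> 'a \<Rightarrow> 'a set" where
  "weak_component G A v = {u. v \<rightarrow>\<^sup>*\<^bsub>with_proj (mk_symmetric (G\<lparr>arcs := A\<rparr>))\<^esub> u}"

text \<open>
  The single vertex that replaces a weak component is named by an arbitrarily chosen
  member of it, so that a contraction has the same vertex type as the original digraph.
\<close>

definition contract_vert :: "('a, 'b) pre_digraph \<Rightarrow> 'b set \<Rightarrow> 'a \<Rightarrow> 'a" where
  "contract_vert G A v = (SOME u. u \<in> weak_component G A v)"

definition contract :: "('a, 'b) pre_digraph \<Rightarrow> 'b set \<Rightarrow> ('a, 'b) pre_digraph" where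
  "contract G A = \<lparr> verts = contract_vert G A ` verts G, arcs = arcs G - A,
     tail = (\<lambda>e. contract_vert G A (tail G e)),
     head = (\<lambda>e. contract_vert G A (head G e)) \<rparr>"

definition deletable :: "('a, 'b) pre_digraph \<Rightarrow> 'b \<Rightarrow> bool" where
  "deletable G e \<longleftrightarrow> e \<in> arcs G \<and> tail G e \<noteq> head G e \<and>
     (\<exists>p. pre_digraph.apath G (tail G e) p (head G e) \<and> e \<notin> set p)"

definition isolated :: "('a, 'b) pre_digraph \<Rightarrow> 'a \<Rightarrow> bool" where
  "isolated G v \<longleftrightarrow> v \<in> verts G \<and> in_arcs G v = {} \<and> out_arcs G v = {}"

inductive cut_minor :: "('a, 'b) pre_digraph \<Rightarrow> ('a, 'b) pre_digraph \<Rightarrow> bool"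
  for G :: "('a, 'b) pre_digraph" where
  refl: "cut_minor G G"
| contract_arc: "cut_minor G H \<Longrightarrow> e \<in> arcs H \<Longrightarrow> cut_minor G (contract H {e})"
| delete_arc: "cut_minor G H \<Longrightarrow> deletable H e \<Longrightarrow> cut_minor G (pre_digraph.del_arc H e)"
| delete_vert: "cut_minor G H \<Longrightarrow> isolated H v \<Longrightarrow> cut_minor G (pre_digraph.del_vert H v)"

definition diamond :: "('a, 'b) pre_digraph \<Rightarrow> bool" where
  "diamond G \<longleftrightarrow> (\<exists>h1 h2 X. h1 \<noteq> h2 \<and> h1 \<notin> X \<and> h2 \<notin> X \<and> finite X \<and> card X \<ge> 3 \<and>
     verts G = {h1, h2} \<union> X \<and>
     (\<forall>x \<in> X.
        (\<exists>e1 e2. out_arcs G x = {e1, e2} \<and> head G e1 = h1 \<and> head G e2 = h2 \<and> in_arcs G x = {}) \<or>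
        (\<exists>e1 e2. in_arcs G x = {e1, e2} \<and> tail G e1 = h1 \<and> tail G e2 = h2 \<and> out_arcs G x = {})) \<and>
     (\<forall>e \<in> arcs G. tail G e \<in> X \<or> head G e \<in> X))"

definition one_way_bipartite :: "nat \<Rightarrow> nat \<Rightarrow> (nat + nat, nat \<times> nat) pre_digraph" where
  "one_way_bipartite n1 n2 = \<lparr> verts = {..<n1} <+> {..<n2}, arcs = {..<n1} \<times> {..<n2},
     tail = (\<lambda>e. Inl (fst e)), head = (\<lambda>e. Inr (snd e)) \<rparr>"

definition one_direction :: "('a, 'b) pre_digraph \<Rightarrow> bool" where
  "one_direction G \<longleftrightarrow> (\<exists>n1 n2. n1 \<ge> 2 \<and> n2 \<ge> 2 \<and> digraph_iso G (one_way_bipartite n1 n2))"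

definition odd_diamond :: "('a, 'b) pre_digraph \<Rightarrow> bool" where
  "odd_diamond G \<longleftrightarrow> diamond G \<and> odd (card (verts G))"

definition odd_one_direction :: "('a, 'b) pre_digraph \<Rightarrow> bool" where
  "odd_one_direction G \<longleftrightarrow> one_direction G \<and> odd (card (verts G))"

end

theory Submission
  imports Defs
begin

text \<open>
  For a weakly connected digraph an odd dijoin amounts to a set \<open>T\<close> of vertices with \<open>|T|\<close> even such
  that \<open>|T \<inter> X|\<close> is odd for every predecessor-closed vertex set \<open>X\<close> for which \<open>X\<close> and its
  complement are connected: pass from an arc set to its vertices of odd degree, and back with a
  \<open>T\<close>-join. Contraction preserves the directed bonds that avoid the contracted arc, and deleting a
  deletable arc \<open>e\<close> changes a dijoin by the cycle that \<open>e\<close> closes with its bypassing path. Hence odd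
  dijoins are inherited by cut minors. Odd diamonds and odd one-directions have none, because an odd
  number of their directed bonds sums to zero modulo 2.

  Conversely take a minimal cut minor without an odd dijoin. Each arc \<open>e\<close> has a set \<open>T e\<close> that is odd
  on all directed bonds avoiding \<open>e\<close>, and no vertex is a cut vertex. If all arcs lie in a single
  directed cut, comparing the sets \<open>T e\<close> for arcs on the two sides of a bond shows that the number of
  vertices is odd and that the digraph is complete bipartite. Otherwise every closed set \<open>X\<close> leaves
  some arc \<open>e\<close> uncut, and the parity of \<open>|T e \<inter> X|\<close> does not depend on \<open>e\<close>. This parity function is
  not a valuation on the lattice of closed sets, as otherwise it would come from an odd dijoin. So
  it fails on some square \<open>C\<close>, \<open>C + u\<close>, \<open>C + v\<close>, \<open>C + u + v\<close>. No arc can avoid all four cuts, so \<open>C\<close>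
  consists of sources and the rest \<open>K\<close> of sinks, and a parity count for the arcs from \<open>C\<close> to \<open>u\<close>
  and \<open>v\<close> leaves only the odd diamond with hubs \<open>u\<close> and \<open>v\<close>.
\<close>

section \<open>Parity systems on the vertices\<close>

text \<open>The scalar product of two sets over the field with two elements. On finite sets it is
  additive in each argument under symmetric difference.\<close>

definition par :: "'a set \<Rightarrow> 'a set \<Rightarrow> bool" where
  "par S X \<longleftrightarrow> odd (card (S \<inter> X))"

lemma par_empty [simp]: "\<not> par S {}"
  by (simp add: par_def)

lemma par_singleton [simp]: "par S {x} \<longleftrightarrow> x \<in> S"
  by (cases "x \<in> S") (auto simp: par_def)

lemma par_singleton_left [simp]: "par {x} X \<longleftrightarrow> x \<in> X"
  by (cases "x \<in> X") (auto simp: par_def)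

lemma par_Un_disjoint:
  assumes "finite S" "A \<inter> B = {}"
  shows "par S (A \<union> B) \<longleftrightarrow> par S A \<noteq> par S B"
proof -
  have "card (S \<inter> (A \<union> B)) = card (S \<inter> A) + card (S \<inter> B)"
    unfolding Int_Un_distrib using assms by (intro card_Un_disjoint) auto
  then show ?thesis by (simp add: par_def)
qed

lemma par_insert:
  assumes "finite S" "a \<notin> A"
  shows "par S (insert a A) \<longleftrightarrow> par S A \<noteq> (a \<in> S)"
  using assms by (auto simp: par_def Int_insert_right)

text \<open>An even \<open>S\<close> does not distinguish a set from its complement, so the parity
  belongs to the cut and not to the chosen side.\<close>

lemma par_Diff:
  assumes "finite V" "S \<subseteq> V" "even (card S)" "X \<subseteq> V"
  shows "par S (V - X) = par S X"
proof -
  have "par S (X \<union> (V - X)) \<longleftrightarrow> par S X \<noteq> par S (V - X)"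
    using assms by (intro par_Un_disjoint) (auto intro: finite_subset)
  moreover have "S \<inter> (X \<union> (V - X)) = S" using assms by auto
  ultimately show ?thesis using assms by (simp add: par_def)
qed

section \<open>Closed sets, connected sets and bond sides of a finite relation\<close>

locale vertex_digraph =
  fixes V :: "'a set" and R :: "('a \<times> 'a) set"
  assumes finite_V: "finite V" and R_sub: "R \<subseteq> V \<times> V"
begin

definition adj :: "'a \<Rightarrow> 'a \<Rightarrow> bool" where
  "adj x y \<longleftrightarrow> (x, y) \<in> R \<or> (y, x) \<in> R"

text \<open>Connectivity of the induced undirected graph, phrased through partitions so that its
  failure yields a split without crossing arcs at once. The empty set counts as connected.\<close>

definition conn :: "'a set \<Rightarrow> bool" where
  "conn X \<longleftrightarrow> (\<forall>P. P \<subseteq> X \<and> P \<noteq> {} \<and> P \<noteq> X \<longrightarrow> (\<exists>x\<in>P. \<exists>y\<in>X - P. adj x y))"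

definition pclosed :: "'a set \<Rightarrow> bool" where
  "pclosed X \<longleftrightarrow> X \<subseteq> V \<and> (\<forall>x y. (x, y) \<in> R \<and> y \<in> X \<longrightarrow> x \<in> X)"

text \<open>In a connected digraph a nonempty cut is minimal exactly when both sides are connected,
  so these are the tail sides of the directed bonds.\<close>

definition bnd :: "'a set \<Rightarrow> bool" where
  "bnd X \<longleftrightarrow> pclosed X \<and> X \<noteq> {} \<and> X \<noteq> V \<and> conn X \<and> conn (V - X)"

definition uncut :: "'a \<times> 'a \<Rightarrow> 'a set \<Rightarrow> bool" where
  "uncut e X \<longleftrightarrow> (fst e \<in> X \<longleftrightarrow> snd e \<in> X)"

lemma adj_sym: "adj x y \<Longrightarrow> adj y x"
  by (auto simp: adj_def)

lemma R_in_V: "(x, y) \<in> R \<Longrightarrow> x \<in> V \<and> y \<in> V"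
  using R_sub by auto

lemma connD:
  assumes "conn X" "P \<subseteq> X" "P \<noteq> {}" "P \<noteq> X"
  obtains x y where "x \<in> P" "y \<in> X - P" "adj x y"
  using assms unfolding conn_def by blast

lemma conn_singleton [simp]: "conn {x}"
  by (auto simp: conn_def)

lemma conn_Un:
  assumes "conn A" "A \<noteq> {}" and nb: "\<And>b. b \<in> B \<Longrightarrow> \<exists>a\<in>A. adj b a"
  shows "conn (A \<union> B)"
  unfolding conn_def
proof (intro allI impI)
  fix P assume P: "P \<subseteq> A \<union> B \<and> P \<noteq> {} \<and> P \<noteq> A \<union> B"
  show "\<exists>x\<in>P. \<exists>y\<in>(A \<union> B) - P. adj x y"
  proof (cases "P \<inter> A = {} \<or> A \<subseteq> P")
    case False
    then obtain x y where "x \<in> P \<inter> A" "y \<in> A - P \<inter> A" "adj x y"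
      using connD[OF \<open>conn A\<close>, of "P \<inter> A"] by blast
    then show ?thesis by blast
  next
    case True
    then show ?thesis
    proof
      assume e: "P \<inter> A = {}"
      obtain b where "b \<in> P" using P by auto
      with e P have "b \<in> B" by auto
      with nb obtain a where "a \<in> A" "adj b a" by blast
      with e \<open>b \<in> P\<close> show ?thesis by blast
    next
      assume s: "A \<subseteq> P"
      then obtain b where "b \<in> B" "b \<notin> P" using P by auto
      with nb obtain a where "a \<in> A" "adj b a" by blast
      with s \<open>b \<in> B\<close> \<open>b \<notin> P\<close> show ?thesis by (meson DiffI UnI2 adj_sym subsetD)
    qed
  qed
qed

lemma conn_star:
  assumes "\<And>b. b \<in> B \<Longrightarrow> adj b a"
  shows "conn (insert a B)"
  using conn_Un[of "{a}" B] assms by auto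

lemma pclosed_subset: "pclosed X \<Longrightarrow> X \<subseteq> V"
  by (simp add: pclosed_def)

lemma pclosedD: "pclosed X \<Longrightarrow> (x, y) \<in> R \<Longrightarrow> y \<in> X \<Longrightarrow> x \<in> X"
  unfolding pclosed_def by blast

lemma pclosed_empty [simp]: "pclosed {}"
  by (simp add: pclosed_def)

lemma pclosed_V [simp]: "pclosed V"
  using R_sub by (auto simp: pclosed_def)

lemma pclosed_Un: "pclosed X \<Longrightarrow> pclosed Y \<Longrightarrow> pclosed (X \<union> Y)"
  unfolding pclosed_def by blast

lemma pclosed_Int: "pclosed X \<Longrightarrow> pclosed Y \<Longrightarrow> pclosed (X \<inter> Y)"
  unfolding pclosed_def by blast

lemma pclosed_insert_insert:
  assumes "pclosed (insert u X)" "pclosed (insert v X)"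
  shows "pclosed (insert u (insert v X))"
  using pclosed_Un[OF assms] by (simp add: insert_commute)

lemma finite_pclosed: "pclosed X \<Longrightarrow> finite X"
  using finite_V finite_subset pclosed_subset by blast

end

text \<open>The data of a minimal cut minor without an odd dijoin: \<open>T e\<close> stems from an
  odd dijoin of the contraction of \<open>e\<close>, \<open>no_T\<close> says that no single vertex
  set serves all bonds, and \<open>no_trans\<close> holds because an arc bypassed by a path of two
  arcs is deletable.\<close>

locale critical_vertex_digraph = vertex_digraph +
  fixes T :: "'a \<times> 'a \<Rightarrow> 'a set"
  assumes conn_V: "conn V"
    and T_sub: "\<And>e. e \<in> R \<Longrightarrow> T e \<subseteq> V"
    and T_even: "\<And>e. e \<in> R \<Longrightarrow> even (card (T e))"
    and T_odd: "\<And>e X. e \<in> R \<Longrightarrow> bnd X \<Longrightarrow> uncut e X \<Longrightarrow> par (T e) X"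
    and no_T: "\<And>S. S \<subseteq> V \<Longrightarrow> even (card S) \<Longrightarrow> \<exists>X. bnd X \<and> \<not> par S X"
    and no_trans: "\<And>x y z. (x, y) \<in> R \<Longrightarrow> (y, z) \<in> R \<Longrightarrow> (x, z) \<notin> R"
begin

lemma finite_T: "e \<in> R \<Longrightarrow> finite (T e)"
  using T_sub finite_V finite_subset by blast

lemma par_T_compl: "e \<in> R \<Longrightarrow> X \<subseteq> V \<Longrightarrow> par (T e) (V - X) = par (T e) X"
  by (intro par_Diff finite_V T_sub T_even)

text \<open>If \<open>e\<close> lay in no directed bond, \<open>T e\<close> would be odd on all of
  them, against \<open>no_T\<close>. This separation stands in for acyclicity below.\<close>

lemma ex_cut:
  assumes "e \<in> R"
  obtains X where "pclosed X" "fst e \<in> X" "snd e \<notin> X"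
proof -
  obtain X where X: "bnd X" "\<not> par (T e) X"
    using no_T[OF T_sub[OF assms] T_even[OF assms]] by blast
  then have "\<not> uncut e X" using T_odd[OF assms] by blast
  moreover have "pclosed X" using X by (simp add: bnd_def)
  ultimately have "fst e \<in> X" "snd e \<notin> X"
    using assms pclosedD[of X "fst e" "snd e"] by (auto simp: uncut_def)
  with \<open>pclosed X\<close> that show ?thesis by blast
qed

lemma irrefl_R: "(x, x) \<notin> R"
  using ex_cut[of "(x, x)"] by auto

lemma ex_vertex: "x \<in> V \<Longrightarrow> \<exists>y\<in>V. y \<noteq> x"
proof (rule ccontr)
  assume "x \<in> V" "\<not> (\<exists>y\<in>V. y \<noteq> x)"
  then have "V = {x}" by blast
  then have "\<not> bnd X" for X unfolding bnd_def using pclosed_subset[of X] by (metis subset_singletonD)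
  then show False using no_T[of "{}"] by auto
qed

lemma ex_adj: "x \<in> V \<Longrightarrow> \<exists>y. adj x y"
  using connD[OF conn_V, of "{x}"] ex_vertex by (metis empty_not_insert insert_subset singletonD bot_least)

text \<open>A cut vertex would split the bonds into two classes, each lying on one side of it, and two of the
  sets \<open>T e\<close> could be glued to a set that is odd on every bond.\<close>

lemma conn_remove_vertex:
  assumes w: "w \<in> V"
  shows "conn (V - {w})"
proof (rule ccontr)
  assume "\<not> conn (V - {w})"
  then obtain A where A: "A \<subseteq> V - {w}" "A \<noteq> {}" "A \<noteq> V - {w}"
    and noadj: "\<And>x y. x \<in> A \<Longrightarrow> y \<in> V - {w} - A \<Longrightarrow> \<not> adj x y"
    unfolding conn_def by blast
  define B where "B = V - {w} - A"
  have B: "B \<subseteq> V - {w}" "B \<noteq> {}" "A \<inter> B = {}" "V = insert w (A \<union> B)"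
    using A w by (auto simp: B_def)
  have ncAB: "\<not> adj x y" "\<not> adj y x" if "x \<in> A" "y \<in> B" for x y
    using noadj that adj_sym by (auto simp: B_def)
  have edge: "\<exists>e\<in>R. fst e \<notin> D \<and> snd e \<notin> D"
    if CD: "C \<noteq> {}" "C \<subseteq> V - {w}" "D \<subseteq> V - {w}" "C \<inter> D = {}" "V = insert w (C \<union> D)"
      and no: "\<And>x y. x \<in> C \<Longrightarrow> y \<in> D \<Longrightarrow> \<not> adj x y" for C D
  proof -
    have "C \<subseteq> V" "C \<noteq> V" using CD w by auto
    then obtain x y where xy: "x \<in> C" "y \<in> V - C" "adj x y" 
      using connD[OF conn_V] CD by metis
    then have "y \<notin> D" "x \<notin> D" using CD no by auto
    moreover have "(x, y) \<in> R \<or> (y, x) \<in> R" using xy by (simp add: adj_def)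
    ultimately show ?thesis by (metis fst_conv snd_conv)
  qed
  obtain e where e: "e \<in> R" "fst e \<notin> A" "snd e \<notin> A"
    using edge[of B A] B A ncAB by (metis Int_commute Un_commute)
  obtain f where f: "f \<in> R" "fst f \<notin> B" "snd f \<notin> B"
    using edge[of A B] B A ncAB by metis
  \<comment> \<open>\<open>e\<close> avoids \<open>A\<close> and \<open>f\<close> avoids
    \<open>B\<close>, so each \<open>T\<close> is used only on the part that its arc does not touch.
    Adding \<open>w\<close> repairs the parity of the cardinality.\<close>
  define S0 where "S0 = (T e \<inter> A) \<union> (T f \<inter> B)"
  define S where "S = (if even (card S0) then S0 else insert w S0)"
  have wA: "w \<notin> A" "w \<notin> B" using A B by auto
  have S0: "S0 \<subseteq> V" "finite S0" "w \<notin> S0" using A B finite_T e f wA by (auto simp: S0_def)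
  have S: "S \<subseteq> V" "even (card S)" "finite S" using S0 w by (auto simp: S_def)
  have SA: "par S Z = par (T e) Z" if "Z \<subseteq> A" for Z
  proof -
    have "S \<inter> Z = T e \<inter> Z" using that wA B by (auto simp: S_def S0_def)
    then show ?thesis by (simp add: par_def)
  qed
  have SB: "par S Z = par (T f) Z" if "Z \<subseteq> B" for Z
  proof -
    have "S \<inter> Z = T f \<inter> Z" using that wA B by (auto simp: S_def S0_def)
    then show ?thesis by (simp add: par_def)
  qed
  have side: "Z \<subseteq> A \<or> Z \<subseteq> B" if "conn Z" "Z \<subseteq> V" "w \<notin> Z" for Z
  proof (rule ccontr)
    assume n: "\<not> ?thesis"
    then have "Z \<inter> A \<noteq> {}" "Z \<inter> A \<noteq> Z" using that B by auto
    then obtain x y where "x \<in> Z \<inter> A" "y \<in> Z - Z \<inter> A" "adj x y"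
      using connD[OF \<open>conn Z\<close>, of "Z \<inter> A"] by (metis Int_lower1)
    then show False using that B ncAB by auto
  qed
  have "par S X" if X: "bnd X" for X
  proof -
    have XV: "X \<subseteq> V" using X pclosed_subset by (auto simp: bnd_def)
    \<comment> \<open>It suffices to treat the side of the bond without \<open>w\<close>: being
      connected, it lies in \<open>A\<close> or in \<open>B\<close>.\<close>
    have main: "par S Z" if Z: "Z \<subseteq> V" "conn Z" "w \<notin> Z" 
      and oe: "\<And>e. e \<in> R \<Longrightarrow> fst e \<notin> Z \<Longrightarrow> snd e \<notin> Z \<Longrightarrow> par (T e) Z" for Z
      using side[OF Z(2,1,3)] oe[OF e(1)] oe[OF f(1)] e f SA SB by blast
    show ?thesis
    proof (cases "w \<in> X")
      case True
      have "par S (V - X)"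
      proof (rule main)
        fix e assume "e \<in> R" "fst e \<notin> V - X" "snd e \<notin> V - X"
        then show "par (T e) (V - X)"
          using T_odd[OF _ X, of e] par_T_compl[of e X] XV R_sub
          by (metis DiffI R_in_V prod.collapse uncut_def)
      qed (use X True in \<open>auto simp: bnd_def\<close>)
      then show ?thesis using par_Diff[OF finite_V S(1,2) XV] by simp
    next
      case False
      show ?thesis
        by (rule main) (use X XV False T_odd in \<open>auto simp: bnd_def uncut_def\<close>)
    qed
  qed
  then show False using no_T S by blast
qed

text \<open>No vertex is a cut vertex, so isolating one source, or one sink as in the next lemma,
  leaves a connected rest and gives a directed bond.\<close>

lemma bnd_source:
  assumes "pclosed {c}" shows "bnd {c}"
  using assms conn_remove_vertex[of c] ex_vertex[of c] by (auto simp: bnd_def pclosed_def)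

lemma bnd_sink:
  assumes "pclosed (V - {k})" "k \<in> V" shows "bnd (V - {k})"
proof -
  have "V - (V - {k}) = {k}" using assms by auto
  then show ?thesis using assms conn_remove_vertex[of k] ex_vertex[of k] by (auto simp: bnd_def)
qed

lemma source_in_T:
  assumes "e \<in> R" "pclosed {c}" "fst e \<noteq> c" "snd e \<noteq> c" shows "c \<in> T e"
  using T_odd[OF assms(1) bnd_source[OF assms(2)]] assms(3,4)
  by (auto simp: uncut_def)

lemma sink_in_T:
  assumes "e \<in> R" "pclosed (V - {k})" "k \<in> V" "fst e \<noteq> k" "snd e \<noteq> k" shows "k \<in> T e"
proof -
  have "par (T e) (V - {k})"
    using T_odd[OF assms(1) bnd_sink[OF assms(2,3)]] assms R_in_V[of "fst e" "snd e"] by (auto simp: uncut_def)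
  then have "par (T e) {k}" using par_T_compl[OF assms(1), of "{k}"] assms by simp
  then show ?thesis by simp
qed

text \<open>Splitting a disconnected side of a directed cut decomposes it into directed bonds, so the
  parity of a cut is determined by the parities of the bonds inside it.\<close>

lemma par_T_indep:
  assumes "pclosed X" "e \<in> R" "f \<in> R" "uncut e X" "uncut f X"
  shows "par (T e) X = par (T f) X"
  using assms
proof (induction "card {d \<in> R. \<not> uncut d X}" arbitrary: X rule: less_induct)
  case less
  note X = less.prems
  have fin: "finite R" using R_sub finite_V finite_subset by blast
  have XV: "X \<subseteq> V" using X pclosed_subset by blast
  show ?case
  proof (cases "X = {} \<or> X = V")
    case True
    have "\<not> par (T d) V" if "d \<in> R" for d using par_T_compl[OF that, of "{}"] by simp
    then show ?thesis using True X by (metis par_empty)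
  next
    case ne: False
    \<comment> \<open>Since \<open>V\<close> is connected, some arc cuts \<open>Q\<close>. That arc
      is cut by \<open>X\<close> but not by \<open>Y\<close>, which makes the induction measure
      drop.\<close>
    have smaller: "card {d \<in> R. \<not> uncut d Y} < card {d \<in> R. \<not> uncut d X}"
      if sub: "\<And>d. d \<in> R \<Longrightarrow> uncut d X \<Longrightarrow> uncut d Y" and Q: "Q \<noteq> {}" "Q \<noteq> V" "Q \<subseteq> V"
        and QY: "\<And>d. d \<in> R \<Longrightarrow> \<not> uncut d Q \<Longrightarrow> uncut d Y \<and> \<not> uncut d X" for Y Q
    proof (rule psubset_card_mono)
      obtain x y where xy: "x \<in> Q" "y \<in> V - Q" "adj x y" using connD[OF conn_V Q(3,1,2)] .
      then obtain d where "d \<in> R" "\<not> uncut d Q" by (force simp: adj_def uncut_def)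
      with sub QY show "{d \<in> R. \<not> uncut d Y} \<subset> {d \<in> R. \<not> uncut d X}" by blast
    qed (use fin in auto)
    show ?thesis
    proof (cases "conn X")
      case False
      then obtain P where P: "P \<subseteq> X" "P \<noteq> {}" "P \<noteq> X"
        and no: "\<And>x y. x \<in> P \<Longrightarrow> y \<in> X - P \<Longrightarrow> \<not> adj x y"
        unfolding conn_def by blast
      define Q where "Q = X - P"
      have Q: "Q \<noteq> {}" "P \<union> Q = X" "P \<inter> Q = {}" using P by (auto simp: Q_def)
      have noPQ: "x \<in> P \<Longrightarrow> y \<in> Q \<Longrightarrow> (x, y) \<notin> R \<and> (y, x) \<notin> R" for x y
        using no by (auto simp: Q_def adj_def)
      have cl: "pclosed P" "pclosed Q"
        using X(1) noPQ Q(2) unfolding pclosed_def by blast+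
      have unP: "uncut d P" and unQ: "uncut d Q" if "d \<in> R" "uncut d X" for d
        using that noPQ[of "fst d" "snd d"] noPQ[of "snd d" "fst d"] Q by (auto simp: uncut_def)
      have cPQ: "uncut d P \<and> \<not> uncut d X" if "d \<in> R" "\<not> uncut d Q" for d
        using that noPQ[of "fst d" "snd d"] noPQ[of "snd d" "fst d"] Q by (auto simp: uncut_def)
      have cQP: "uncut d Q \<and> \<not> uncut d X" if "d \<in> R" "\<not> uncut d P" for d
        using that noPQ[of "fst d" "snd d"] noPQ[of "snd d" "fst d"] Q by (auto simp: uncut_def)
      have "par (T e) P = par (T f) P"
        by (rule less.hyps[OF smaller[of P Q]]) (use cl Q P XV X unP cPQ ne in auto)
      moreover have "par (T e) Q = par (T f) Q"
        by (rule less.hyps[OF smaller[of Q P]]) (use cl Q P XV X unQ cQP ne in auto)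
      ultimately show ?thesis
        using par_Un_disjoint[OF finite_T Q(3)] X Q(2) by metis
    next
      case cX: True
      show ?thesis
      proof (cases "conn (V - X)")
        case True
        then have "bnd X" using cX ne X by (auto simp: bnd_def)
        then show ?thesis using T_odd X by blast
      next
        case False
        then obtain P where P: "P \<subseteq> V - X" "P \<noteq> {}" "P \<noteq> V - X"
          and no: "\<And>x y. x \<in> P \<Longrightarrow> y \<in> V - X - P \<Longrightarrow> \<not> adj x y"
          unfolding conn_def by blast
        \<comment> \<open>The closed sets to recurse on are \<open>V - P\<close> and
          \<open>V - Q\<close>. Parities are added on \<open>P\<close> and \<open>Q\<close>, which
          have the parities of their complements because each \<open>T d\<close> has even
          size.\<close>
        define Q where "Q = V - X - P"
        have Q: "Q \<noteq> {}" "Q \<subseteq> V" "P \<union> Q = V - X" "P \<inter> Q = {}" "X \<inter> P = {}" "X \<inter> Q = {}" "V = X \<union> P \<union> Q"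
          using P XV by (auto simp: Q_def)
        have noPQ: "x \<in> P \<Longrightarrow> y \<in> Q \<Longrightarrow> (x, y) \<notin> R \<and> (y, x) \<notin> R" for x y
          using no by (auto simp: Q_def adj_def)
        have PV: "P \<subseteq> V" using P by auto
        have noPX: "(x, y) \<notin> R" if "x \<in> P \<union> Q" "y \<in> X" for x y
          using X(1) that Q pclosedD by blast
        have cl: "pclosed (V - P)" "pclosed (V - Q)"
          unfolding pclosed_def using noPQ noPX R_in_V Q by blast+
        have dV: "fst d \<in> X \<union> P \<union> Q" "snd d \<in> X \<union> P \<union> Q" "(fst d, snd d) \<in> R" if "d \<in> R" for d
          using that R_sub Q(7) by (auto simp: mem_Times_iff)
        have unP: "uncut d (V - P)" and unQ: "uncut d (V - Q)" if "d \<in> R" "uncut d X" for d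
          using that dV[of d] noPQ Q unfolding uncut_def by blast+
        have cPQ: "uncut d (V - P) \<and> \<not> uncut d X" if "d \<in> R" "\<not> uncut d Q" for d
          using that dV[of d] noPQ Q unfolding uncut_def by blast
        have cQP: "uncut d (V - Q) \<and> \<not> uncut d X" if "d \<in> R" "\<not> uncut d P" for d
          using that dV[of d] noPQ Q unfolding uncut_def by blast
        have "par (T e) (V - P) = par (T f) (V - P)"
          by (rule less.hyps[OF smaller[of "V - P" Q]]) (use cl Q P XV X unP cPQ ne in auto)
        moreover have "par (T e) (V - Q) = par (T f) (V - Q)"
          by (rule less.hyps[OF smaller[of "V - Q" P]]) (use cl Q P XV X unQ cQP ne in auto)
        ultimately have "par (T e) (V - X) = par (T f) (V - X)"
          using par_Un_disjoint[OF finite_T Q(4)] X Q(2,3) PV par_T_compl by metis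
        then show ?thesis using par_T_compl X XV by metis
      qed
    qed
  qed
qed

end

section \<open>Digraphs covered by a single directed cut\<close>

context vertex_digraph
begin

text \<open>\<open>M\<close> is the component of \<open>y\<close> outside the connected set
  \<open>X\<close>. Every other component there is attached to \<open>X\<close> because
  \<open>V\<close> is connected, so the complement of \<open>M\<close> is connected too.\<close>

lemma ex_component:
  assumes V: "conn V" and X: "conn X" "X \<noteq> {}" "X \<subseteq> V" and y: "y \<in> V - X"
  obtains M where "y \<in> M" "M \<subseteq> V - X" "conn M" "conn (V - M)"
    "\<And>a b. a \<in> M \<Longrightarrow> b \<in> V - X \<Longrightarrow> adj a b \<Longrightarrow> b \<in> M"
proof -
  define E where "E = {(a, b). adj a b \<and> a \<in> V - X \<and> b \<in> V - X}"
  define M where "M = {b. (y, b) \<in> E\<^sup>*}"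
  have yM: "y \<in> M" by (simp add: M_def)
  have step: "b \<in> M" if "a \<in> M" "a \<in> V - X" "b \<in> V - X" "adj a b" for a b
    using that unfolding M_def E_def by (auto intro: rtrancl_into_rtrancl)
  have MX: "M \<subseteq> V - X"
  proof
    fix b assume "b \<in> M"
    then have "(y, b) \<in> E\<^sup>*" by (simp add: M_def)
    then show "b \<in> V - X" by induction (use y in \<open>auto simp: E_def\<close>)
  qed
  have cl: "b \<in> M" if "a \<in> M" "b \<in> V - X" "adj a b" for a b
    using that MX step by blast
  have cM: "conn M"
    unfolding conn_def
  proof (intro allI impI, rule ccontr)
    fix P assume P: "P \<subseteq> M \<and> P \<noteq> {} \<and> P \<noteq> M" and "\<not> (\<exists>x\<in>P. \<exists>y\<in>M - P. adj x y)"
    then have no: "\<not> adj a b" "\<not> adj b a" if "a \<in> P" "b \<in> M - P" for a b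
      using that adj_sym by blast+
    have "b \<in> P \<longleftrightarrow> y \<in> P" if "(y, b) \<in> E\<^sup>*" for b
      using that
    proof induction
      case (step b c)
      then have "b \<in> M" "c \<in> M" "adj b c"
        by (auto simp: M_def E_def intro: rtrancl_into_rtrancl)
      with step no show ?case by blast
    qed simp
    then show False using P yM unfolding M_def by blast
  qed
  have cVM: "conn (V - M)"
    unfolding conn_def
  proof (intro allI impI, rule ccontr)
    fix P assume P: "P \<subseteq> V - M \<and> P \<noteq> {} \<and> P \<noteq> V - M" and "\<not> (\<exists>x\<in>P. \<exists>y\<in>V - M - P. adj x y)"
    then have no: "\<not> adj a b" "\<not> adj b a" if "a \<in> P" "b \<in> V - M - P" for a b
      using that adj_sym by blast+
    define P' where "P' = V - M - P"
    have P': "P' \<subseteq> V - M" "P' \<noteq> {}" using P by (auto simp: P'_def)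
    \<comment> \<open>One part of the split misses the connected set \<open>X\<close>. An adjacency
      leaving that part must lead to \<open>M\<close>, against the closure of \<open>M\<close> under
      adjacency outside \<open>X\<close>.\<close>
    have "\<exists>Q. Q \<subseteq> V - M \<and> Q \<noteq> {} \<and> X \<inter> Q = {} \<and> (\<forall>a\<in>Q. \<forall>b\<in>V - M - Q. \<not> adj a b)"
    proof (cases "X \<inter> P = {}")
      case True
      then show ?thesis using P no by blast
    next
      case False
      have "X \<subseteq> P"
      proof (rule ccontr)
        assume "\<not> X \<subseteq> P"
        then obtain a b where "a \<in> X \<inter> P" "b \<in> X - X \<inter> P" "adj a b"
          using connD[OF X(1), of "X \<inter> P"] False by (metis Int_lower1 inf.absorb_iff1)
        then show False using no[of a b] MX X by blast
      qed
      moreover have "V - M - P' = P" using P by (auto simp: P'_def)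
      ultimately show ?thesis using P' no by (intro exI[of _ P']) (auto simp: P'_def)
    qed
    then obtain Q where Q: "Q \<subseteq> V - M" "Q \<noteq> {}" "X \<inter> Q = {}"
      "\<And>a b. a \<in> Q \<Longrightarrow> b \<in> V - M - Q \<Longrightarrow> \<not> adj a b" by blast
    have "Q \<subseteq> V" "Q \<noteq> V" using Q X by auto
    then obtain a b where ab: "a \<in> Q" "b \<in> V - Q" "adj a b" using connD[OF V _ Q(2)] by metis
    then have "b \<in> M" using Q by blast
    then have "a \<in> M" using cl[of b a] ab Q adj_sym by blast
    then show False using ab Q by blast
  qed
  show thesis by (rule that[OF yM MX cM cVM cl])
qed

end

context critical_vertex_digraph
begin

text \<open>Every vertex of \<open>C\<close> is a source and every other vertex a sink, so
  \<open>T e\<close> contains all vertices except possibly the ends of \<open>e\<close>. Hence a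
  bond side that avoids both ends of an uncut arc has odd size, and a bond with uncut arcs on both
  sides makes \<open>card V\<close> even.\<close>

lemma one_way_case:
  assumes C: "pclosed C" and cut: "\<And>e. e \<in> R \<Longrightarrow> \<not> uncut e C"
  shows "R = C \<times> (V - C)" "odd (card V)" "2 \<le> card C" "2 \<le> card (V - C)"
proof -
  have CV: "C \<subseteq> V" using C pclosed_subset by blast
  have RC: "x \<in> C \<and> y \<in> V - C" if "(x, y) \<in> R" for x y
    using cut[OF that] pclosedD[OF C that] R_in_V[OF that] by (auto simp: uncut_def)
  have src: "pclosed {c}" if "c \<in> C" for c
    using that CV RC by (force simp: pclosed_def)
  have snk: "pclosed (V - {k})" if "k \<in> V - C" for k
    using that RC R_in_V unfolding pclosed_def by blast
  have inT: "w \<in> T e" if "e \<in> R" "w \<in> V" "w \<noteq> fst e" "w \<noteq> snd e" for e w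
    using that source_in_T[OF that(1) src, of w] sink_in_T[OF that(1) snk, of w] by blast
  have par_full: "par (T e) Z \<longleftrightarrow> odd (card Z)" if "e \<in> R" "Z \<subseteq> V" "fst e \<notin> Z" "snd e \<notin> Z" for e Z
  proof -
    have "T e \<inter> Z = Z" using inT[OF that(1)] that by blast
    then show ?thesis by (simp add: par_def)
  qed
  have outside: "odd (card X)" if "bnd X" "e \<in> R" "fst e \<notin> X" "snd e \<notin> X" for X e
    using that T_odd[OF that(2,1)] par_full[OF that(2)] pclosed_subset
    by (auto simp: uncut_def bnd_def)
  have inside: "odd (card (V - X))" if "bnd X" "e \<in> R" "fst e \<in> X" "snd e \<in> X" for X e
    using that T_odd[OF that(2,1)] par_full[OF that(2), of "V - X"] pclosed_subset
      par_T_compl[OF that(2), of X] by (auto simp: uncut_def bnd_def)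
  have card_split: "card V = card X + card (V - X)" if "bnd X" for X
  proof -
    have "X \<subseteq> V" using that pclosed_subset by (auto simp: bnd_def)
    then show ?thesis using finite_V by (simp add: card_Diff_subset card_mono finite_subset)
  qed
  show odd: "odd (card V)"
  proof (rule ccontr)
    assume ev: "\<not> odd (card V)"
    \<comment> \<open>For even \<open>card V\<close> the set \<open>V\<close> itself would be odd on
      every bond, against \<open>no_T\<close>.\<close>
    have "par V X" if X: "bnd X" for X
    proof -
      have XV: "X \<subseteq> V" using X pclosed_subset by (auto simp: bnd_def)
      have "odd (card X)"
      proof (cases "\<exists>e\<in>R. uncut e X")
        case True
        then obtain e where e: "e \<in> R" "uncut e X" by blast
        then consider "fst e \<in> X" "snd e \<in> X" | "fst e \<notin> X" "snd e \<notin> X" by (auto simp: uncut_def)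
        then show ?thesis
          using inside[OF X e(1)] outside[OF X e(1)] card_split[OF X] ev by cases auto
      next
        case False
        obtain x where x: "x \<in> X" using X by (auto simp: bnd_def)
        \<comment> \<open>With all arcs cut, no two vertices of \<open>X\<close> are adjacent, and a
          nonempty connected set without adjacencies is a single vertex.\<close>
        have "X = {x}"
        proof (rule ccontr)
          assume "X \<noteq> {x}"
          then obtain a b where "a \<in> {x}" "b \<in> X - {x}" "adj a b"
            using connD[of X "{x}"] X x by (metis bnd_def empty_not_insert empty_subsetI insert_subset)
          then show False using False x by (auto simp: adj_def uncut_def)
        qed
        then show ?thesis by simp
      qed
      then show ?thesis using XV by (simp add: par_def Int_absorb1)
    qed
    then show False using no_T[of V] ev by auto
  qed
  have full: "(c, k) \<in> R" if c: "c \<in> C" and k: "k \<in> V - C" for c k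
  proof (rule ccontr)
    assume nck: "(c, k) \<notin> R"
    \<comment> \<open>The star of \<open>k\<close> is closed and misses \<open>c\<close>. If
      \<open>M\<close> is the component of \<open>c\<close> outside it, the bond of
      \<open>V - M\<close> leaves \<open>(c, k1)\<close> on one side and \<open>(c1, k)\<close> on
      the other, so both sides are odd and \<open>card V\<close> would be even.\<close>
    define N where "N = {x. (x, k) \<in> R}"
    define X where "X = insert k N"
    have NC: "N \<subseteq> C" using RC by (auto simp: N_def)
    obtain c1 where "adj k c1" using ex_adj[of k] k by blast
    then have c1: "(c1, k) \<in> R" using RC k by (auto simp: adj_def)
    obtain k1 where "adj c k1" using ex_adj[of c] c CV by blast
    then have k1: "(c, k1) \<in> R" using RC c by (auto simp: adj_def)
    have k1X: "k1 \<notin> X" using RC[OF k1] NC nck k1 by (auto simp: X_def)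
    have XV: "X \<subseteq> V" using k NC CV by (auto simp: X_def)
    have Xne: "X \<noteq> {}" by (simp add: X_def)
    have cX: "conn X" unfolding X_def by (rule conn_star) (auto simp: N_def adj_def)
    have clX: "pclosed X" unfolding pclosed_def using XV RC NC by (auto simp: X_def N_def)
    have cX': "c \<in> V - X" using c CV k nck by (auto simp: X_def N_def)
    obtain M where M: "c \<in> M" "M \<subseteq> V - X" "conn M" "conn (V - M)"
      "\<And>a b. a \<in> M \<Longrightarrow> b \<in> V - X \<Longrightarrow> adj a b \<Longrightarrow> b \<in> M"
      using ex_component[OF conn_V cX Xne XV cX'] by blast
    have k1M: "k1 \<in> M" using M(5)[OF M(1), of k1] k1 k1X R_in_V by (auto simp: adj_def)
    have VM: "V - (V - M) = M" using M by auto
    have cl: "pclosed (V - M)"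
      unfolding pclosed_def
    proof (intro conjI allI impI)
      fix x y assume xy: "(x, y) \<in> R \<and> y \<in> V - M"
      then have "x \<in> V" using R_in_V by blast
      moreover have "x \<notin> M"
      proof
        assume xM: "x \<in> M"
        show False
        proof (cases "y \<in> X")
          case True
          then have "x \<in> X" using pclosedD[OF clX] xy by blast
          then show False using xM M by blast
        next
          case False
          then show False using M(5)[OF xM, of y] xy by (auto simp: adj_def)
        qed
      qed
      ultimately show "x \<in> V - M" by blast
    qed auto
    have kM: "k \<notin> M" "c1 \<notin> M" using M(2) c1 by (auto simp: X_def N_def)
    have b: "bnd (V - M)" using cl M VM k kM by (auto simp: bnd_def)
    have "odd (card (V - M))"
      using outside[OF b k1] M(1) k1M by simp
    moreover have "odd (card (V - (V - M)))"
      using inside[OF b c1] kM k R_in_V[OF c1] by simp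
    ultimately show False using odd card_split[OF b] by simp
  qed
  show RCK: "R = C \<times> (V - C)" using full RC by auto
  have Rne: "R \<noteq> {}"
  proof
    assume "R = {}"
    obtain x where "x \<in> V" using odd by fastforce
    then obtain y where "adj x y" using ex_adj by blast
    then show False unfolding adj_def using \<open>R = {}\<close> by blast
  qed
  have cs: "card V = card C + card (V - C)" using CV finite_V by (simp add: card_Diff_subset card_mono finite_subset)
  have finC: "finite C" "finite (V - C)" using CV finite_V finite_subset by auto
  have ne: "card C \<noteq> 0" "card (V - C) \<noteq> 0" using Rne RCK finC by auto
  \<comment> \<open>If one part were a single vertex, removing it would leave an independent set
    that is still connected, hence one vertex, and \<open>card V\<close> would be 2.\<close>
  have small: False if "card A = 1" "V = A \<union> B" "A \<inter> B = {}" and nb: "\<And>x y. x \<in> B \<Longrightarrow> y \<in> B \<Longrightarrow> \<not> adj x y"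
      and cB: "card B \<noteq> 0" "card V = card A + card B" for A B
  proof -
    obtain a where a: "A = {a}" using \<open>card A = 1\<close> card_1_singletonE by blast
    then have VB: "V - {a} = B" "a \<in> V" using that by auto
    obtain b where b: "b \<in> B" using cB by fastforce
    have "B \<noteq> {b}" using odd that by auto
    then obtain x y where "x \<in> {b}" "y \<in> B - {b}" "adj x y"
      using connD[of B "{b}"] conn_remove_vertex[OF VB(2)] VB b by (metis empty_not_insert empty_subsetI insert_subset)
    then show False using nb b by blast
  qed
  have "card C \<noteq> 1" using small[of C "V - C"] ne cs CV RC by (force simp: adj_def)
  then show "2 \<le> card C" using ne by linarith
  have "card (V - C) \<noteq> 1" using small[of "V - C" C] ne cs CV RC by (force simp: adj_def)
  then show "2 \<le> card (V - C)" using ne by linarith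
qed

end

section \<open>Failure of modularity on a square\<close>

locale critical_mixed_vertex_digraph = critical_vertex_digraph +
  assumes ex_uncut: "\<And>X. pclosed X \<Longrightarrow> \<exists>e\<in>R. uncut e X"
begin

text \<open>The parity on which all \<open>T e\<close> with \<open>e\<close> uncut by a closed
  \<open>X\<close> agree: \<open>par_T_indep\<close> makes the choice immaterial and
  \<open>ex_uncut\<close> provides a candidate.\<close>

definition cut_par :: "'a set \<Rightarrow> bool" where
  "cut_par X = par (T (SOME e. e \<in> R \<and> uncut e X)) X"

lemma cut_par_eq:
  assumes "pclosed X" "e \<in> R" "uncut e X"
  shows "cut_par X = par (T e) X"
proof -
  have "\<exists>e. e \<in> R \<and> uncut e X" using assms by blast
  then have "(SOME e. e \<in> R \<and> uncut e X) \<in> R \<and> uncut (SOME e. e \<in> R \<and> uncut e X) X"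
    by (rule someI_ex)
  then show ?thesis unfolding cut_par_def using par_T_indep assms by blast
qed

lemma cut_par_bnd: "bnd X \<Longrightarrow> cut_par X"
  using cut_par_eq ex_uncut T_odd by (metis bnd_def)

lemma cut_par_empty: "\<not> cut_par {}"
  by (simp add: cut_par_def)

lemma cut_par_V: "\<not> cut_par V"
proof -
  obtain e where e: "e \<in> R" "uncut e V" using ex_uncut pclosed_V by blast
  then show ?thesis using cut_par_eq[of V e] par_T_compl[of e "{}"] by simp
qed

text \<open>An arc uncut by \<open>insert c Y\<close> cannot be incident with the source
  \<open>c\<close>, so it is uncut by \<open>Y\<close> as well. Its \<open>T e\<close> computes both
  values and contains \<open>c\<close>.\<close>

lemma cut_par_source:
  assumes Y: "pclosed Y" and c: "pclosed {c}" "c \<notin> Y"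
  shows "cut_par (insert c Y) \<longleftrightarrow> \<not> cut_par Y"
proof -
  have cl: "pclosed (insert c Y)" using pclosed_Un[OF c(1) Y] by simp
  then obtain e where e: "e \<in> R" "uncut e (insert c Y)" using ex_uncut by blast
  then have R: "(fst e, snd e) \<in> R" by simp
  have nc: "snd e \<noteq> c"
  proof
    assume *: "snd e = c"
    then have "fst e = c" using pclosedD[OF c(1) R] by simp
    with * R irrefl_R[of c] show False by simp
  qed
  have nc': "fst e \<noteq> c" using e nc pclosedD[OF Y R] c(2) by (auto simp: uncut_def)
  have "uncut e Y" using e nc nc' by (auto simp: uncut_def)
  then show ?thesis
    using cut_par_eq[OF cl e] cut_par_eq[OF Y e(1)] source_in_T[OF e(1) c(1) nc' nc]
      par_insert[OF finite_T[OF e(1)] c(2)] by blast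
qed

text \<open>An arc uncut by \<open>Y\<close> avoids the sink \<open>k\<close>: it cannot start
  there, and if it ended there, its tail would lie in \<open>Y\<close> and the arc would be cut. One
  \<open>T e\<close> containing \<open>k\<close> thus computes both values.\<close>

lemma cut_par_sink:
  assumes Y: "pclosed Y" "pclosed (insert k Y)" and k: "pclosed (V - {k})" "k \<in> V" "k \<notin> Y"
  shows "cut_par (insert k Y) \<longleftrightarrow> \<not> cut_par Y"
proof -
  obtain e where e: "e \<in> R" "uncut e Y" using ex_uncut Y(1) by blast
  then have R: "(fst e, snd e) \<in> R" by simp
  have nk: "fst e \<noteq> k" using pclosedD[OF k(1) R] irrefl_R[of k] R R_in_V[OF R] by (metis DiffE DiffI singletonD singletonI)
  have nk': "snd e \<noteq> k" using e nk pclosedD[OF Y(2) R] k(3) by (auto simp: uncut_def)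
  have "uncut e (insert k Y)" using e nk nk' by (auto simp: uncut_def)
  then show ?thesis
    using cut_par_eq[OF Y(1) e] cut_par_eq[OF Y(2) e(1)] sink_in_T[OF e(1) k(1,2) nk nk']
      par_insert[OF finite_T[OF e(1)] k(3)] by blast
qed

text \<open>A smallest failure of modularity: adding \<open>u\<close> flips \<open>cut_par\<close>
  at exactly one of \<open>X\<close> and \<open>X + v\<close>.\<close>

definition bad_square :: "'a set \<Rightarrow> 'a \<Rightarrow> 'a \<Rightarrow> bool" where
  "bad_square X u v \<longleftrightarrow> pclosed X \<and> pclosed (insert u X) \<and> pclosed (insert v X) \<and>
     u \<notin> X \<and> v \<notin> X \<and> u \<noteq> v \<and>
     (cut_par X \<noteq> cut_par (insert u X)) \<noteq> (cut_par (insert v X) \<noteq> cut_par (insert u (insert v X)))"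

text \<open>If one arc were uncut by all four sets, its \<open>T e\<close> would compute all four
  values, and \<open>par (T e)\<close> is additive, so the square would not be bad.\<close>

lemma bad_square_no_arcs:
  assumes bad: "bad_square X u v" and e: "e \<in> R"
  shows "\<not> (fst e \<in> X \<and> snd e \<in> X)" "\<not> (fst e \<notin> insert u (insert v X) \<and> snd e \<notin> insert u (insert v X))"
proof -
  have "\<not> (uncut e X \<and> uncut e (insert u X) \<and> uncut e (insert v X) \<and> uncut e (insert u (insert v X)))"
  proof
    assume un: "uncut e X \<and> uncut e (insert u X) \<and> uncut e (insert v X) \<and> uncut e (insert u (insert v X))"
    have cl: "pclosed X" "pclosed (insert u X)" "pclosed (insert v X)" "pclosed (insert u (insert v X))"
      and n: "u \<notin> X" "v \<notin> X" "u \<notin> insert v X"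
      using bad pclosed_insert_insert by (auto simp: bad_square_def)
    show False
      using bad cut_par_eq[OF cl(1) e] cut_par_eq[OF cl(2) e] cut_par_eq[OF cl(3) e] cut_par_eq[OF cl(4) e] un
        par_insert[OF finite_T[OF e] n(1)] par_insert[OF finite_T[OF e] n(2)] par_insert[OF finite_T[OF e] n(3)]
      unfolding bad_square_def by blast
  qed
  then show "\<not> (fst e \<in> X \<and> snd e \<in> X)" "\<not> (fst e \<notin> insert u (insert v X) \<and> snd e \<notin> insert u (insert v X))"
    by (auto simp: uncut_def)
qed

text \<open>Take a smallest closed \<open>Z\<close> strictly above \<open>X\<close> and inside
  \<open>Y\<close>. An arc within \<open>Z - X\<close> would be cut by some closed \<open>W\<close>,
  and \<open>X\<close> together with \<open>Z \<inter> W\<close> would be smaller. So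
  \<open>Z - X\<close> spans no arc and any of its vertices can be added.\<close>

lemma ex_pclosed_insert:
  assumes "pclosed X" "pclosed Y" "X \<subseteq> Y" "X \<noteq> Y"
  obtains a where "a \<in> Y - X" "pclosed (insert a X)"
proof -
  define P where "P = (\<lambda>Z. pclosed Z \<and> X \<subseteq> Z \<and> X \<noteq> Z \<and> Z \<subseteq> Y)"
  define Z where "Z = arg_min card P"
  have "P Y" using assms by (simp add: P_def)
  then have Z: "P Z" "\<And>W. P W \<Longrightarrow> card Z \<le> card W"
    unfolding Z_def using arg_min_natI[of P Y card] arg_min_nat_le[of P _ card] by auto
  then obtain a where a: "a \<in> Z - X" by (auto simp: P_def)
  have finZ: "finite Z" using Z(1) finite_pclosed by (auto simp: P_def)
  have noarc: "\<not> (x \<in> Z - X \<and> y \<in> Z - X)" if xy: "(x, y) \<in> R" for x y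
  proof
    assume A: "x \<in> Z - X \<and> y \<in> Z - X"
    obtain W where W: "pclosed W" "x \<in> W" "y \<notin> W" using ex_cut[OF xy] by auto
    have "P (X \<union> (Z \<inter> W))"
      using Z(1) W A assms pclosed_Un pclosed_Int unfolding P_def by blast
    moreover have "card (X \<union> (Z \<inter> W)) < card Z"
      by (rule psubset_card_mono[OF finZ]) (use Z(1) A W in \<open>auto simp: P_def\<close>)
    ultimately show False using Z(2) by fastforce
  qed
  have "pclosed (insert a X)"
    unfolding pclosed_def
  proof (intro conjI allI impI)
    show "insert a X \<subseteq> V" using a Z(1) pclosed_subset by (auto simp: P_def)
    fix x y assume xy: "(x, y) \<in> R \<and> y \<in> insert a X"
    show "x \<in> insert a X"
    proof (cases "y = a")
      case True
      then have "x \<in> Z" using xy a Z(1) pclosedD by (auto simp: P_def)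
      then show ?thesis using noarc[of x y] xy True a by blast
    qed (use xy assms(1) pclosedD in blast)
  qed
  then show thesis using that a Z(1) by (auto simp: P_def)
qed

text \<open>If no square is bad, then \<open>cut_par\<close> is a valuation on the lattice of closed sets and is given
  by a set of vertices that contradicts minimality.\<close>

lemma ex_bad_square: "\<exists>X u v. bad_square X u v"
proof (rule ccontr)
  assume no: "\<not> ?thesis"
  define addable where "addable = (\<lambda>v X. pclosed X \<and> pclosed (insert v X) \<and> v \<notin> X)"
  define jump where "jump = (\<lambda>v X. cut_par X \<noteq> cut_par (insert v X))"
  \<comment> \<open>A chain of closed sets growing by single vertices leads from \<open>X\<close> to
    \<open>Y\<close>. Each link is a square that is not bad, so the jump at \<open>v\<close> is
    preserved.\<close>
  have mono: "jump v X = jump v Y" if "addable v X" "addable v Y" "X \<subseteq> Y" for v X Y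
    using that
  proof (induction "card (Y - X)" arbitrary: X rule: less_induct)
    case less
    show ?case
    proof (cases "X = Y")
      case False
      then obtain a where a: "a \<in> Y - X" "pclosed (insert a X)"
        using ex_pclosed_insert less.prems by (metis addable_def)
      have av: "a \<noteq> v" using a less.prems by (auto simp: addable_def)
      have cl: "pclosed (insert a (insert v X))"
        using pclosed_insert_insert[of a X v] a less.prems by (auto simp: addable_def)
      have finY: "finite (Y - X)" using less.prems finite_pclosed by (auto simp: addable_def)
      have "\<not> bad_square X v a" using no by blast
      then have "jump v X = jump v (insert a X)"
        using less.prems a av by (auto simp: bad_square_def jump_def addable_def insert_commute)
      moreover have "jump v (insert a X) = jump v Y"
      proof (rule less.hyps)
        show "card (Y - insert a X) < card (Y - X)"
          by (rule psubset_card_mono[OF finY]) (use a in auto)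
        show "addable v (insert a X)"
          using less.prems a av cl by (auto simp: addable_def insert_commute)
      qed (use less.prems a in auto)
      ultimately show ?thesis by simp
    qed simp
  qed
  \<comment> \<open>Two arbitrary closed sets are compared through their intersection.\<close>
  have indep: "jump v X = jump v Y" if "addable v X" "addable v Y" for v X Y
  proof -
    have "addable v (X \<inter> Y)"
      using that pclosed_Int[of X Y] pclosed_Int[of "insert v X" "insert v Y"] by (auto simp: addable_def)
    then show ?thesis using mono[of v "X \<inter> Y" X] mono[of v "X \<inter> Y" Y] that by auto
  qed
  \<comment> \<open>\<open>S\<close> collects the vertices whose addition flips
    \<open>cut_par\<close>. Telescoping along a chain from the empty set then gives
    \<open>cut_par X = par S X\<close>.\<close>
  define S where "S = {v \<in> V. \<exists>X. addable v X \<and> jump v X}"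
  have SV: "S \<subseteq> V" by (auto simp: S_def)
  have finS: "finite S" using SV finite_V finite_subset by blast
  have S_iff: "v \<in> S \<longleftrightarrow> jump v X" if "addable v X" for v X
    using that indep[OF that] pclosed_subset unfolding S_def addable_def by blast
  have val: "cut_par Y = (cut_par X \<noteq> par S (Y - X))" if "pclosed X" "pclosed Y" "X \<subseteq> Y" for X Y
    using that
  proof (induction "card (Y - X)" arbitrary: X rule: less_induct)
    case less
    show ?case
    proof (cases "X = Y")
      case False
      then obtain a where a: "a \<in> Y - X" "pclosed (insert a X)"
        using ex_pclosed_insert less.prems by metis
      have finY: "finite (Y - X)" using less.prems finite_pclosed by auto
      have "cut_par Y = (cut_par (insert a X) \<noteq> par S (Y - insert a X))"
      proof (rule less.hyps)
        show "card (Y - insert a X) < card (Y - X)"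
          by (rule psubset_card_mono[OF finY]) (use a in auto)
      qed (use less.prems a in auto)
      moreover have "a \<in> S \<longleftrightarrow> jump a X" by (rule S_iff) (use a less.prems in \<open>auto simp: addable_def\<close>)
      moreover have "Y - X = insert a (Y - insert a X)" using a by auto
      ultimately show ?thesis
        using par_insert[OF finS, of a "Y - insert a X"] unfolding jump_def by auto
    qed simp
  qed
  have "par S X" if "bnd X" for X
    using val[of "{}" X] cut_par_empty cut_par_bnd[OF that] that by (auto simp: bnd_def)
  moreover have "even (card S)"
    using val[of "{}" V] cut_par_empty cut_par_V SV by (auto simp: par_def Int_absorb2)
  ultimately show False using no_T SV by blast
qed

lemma bad_square_sym: "bad_square X u v \<Longrightarrow> bad_square X v u"
  unfolding bad_square_def by (auto simp: insert_commute)

section \<open>Structure of the digraph around a bad square\<close>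

context
  fixes C u v
  assumes bad: "bad_square C u v"
begin

definition K where "K = V - insert u (insert v C)"

lemma square_facts:
  "pclosed C" "pclosed (insert u C)" "pclosed (insert v C)" "pclosed (insert u (insert v C))"
  "u \<notin> C" "v \<notin> C" "u \<noteq> v" "u \<in> V" "v \<in> V" "C \<subseteq> V"
proof -
  show cl: "pclosed C" "pclosed (insert u C)" "pclosed (insert v C)"
    and "u \<notin> C" "v \<notin> C" "u \<noteq> v"
    using bad by (simp_all add: bad_square_def)
  show "pclosed (insert u (insert v C))" using pclosed_insert_insert[OF cl(2,3)] .
  show "u \<in> V" "v \<in> V" "C \<subseteq> V"
    using cl[THEN pclosed_subset] by auto
qed

text \<open>No arc lies inside \<open>C\<close> or inside \<open>K\<close>, and closedness of the
  four sets orients the others. As both \<open>C + u\<close> and \<open>C + v\<close> are closed,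
  there is no arc between \<open>u\<close> and \<open>v\<close>.\<close>

lemma R_cases:
  assumes "(x, y) \<in> R"
  shows "x \<in> C \<and> y \<in> {u, v} \<union> K \<or> x \<in> {u, v} \<and> y \<in> K"
proof -
  have V: "x \<in> V" "y \<in> V" using R_in_V[OF assms] by auto
  have "\<not> (x \<in> C \<and> y \<in> C)" "\<not> (x \<in> K \<and> y \<in> K)"
    using bad_square_no_arcs[OF bad assms] by (auto simp: K_def)
  moreover have "y \<in> C \<Longrightarrow> x \<in> C" "y \<in> insert u C \<Longrightarrow> x \<in> insert u C" "y \<in> insert v C \<Longrightarrow> x \<in> insert v C"
    "y \<in> insert u (insert v C) \<Longrightarrow> x \<in> insert u (insert v C)"
    using square_facts(1-4) pclosedD assms by blast+
  moreover have "x \<noteq> y" using irrefl_R assms by auto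
  ultimately show ?thesis using V square_facts by (auto simp: K_def)
qed

lemma pclosed_C_subset:
  assumes "D \<subseteq> C" shows "pclosed D"
  unfolding pclosed_def
proof (intro conjI allI impI)
  show "D \<subseteq> V" using assms square_facts(10) by simp
  fix x y assume "(x, y) \<in> R \<and> y \<in> D"
  then have "y \<in> {u, v} \<union> K" "y \<in> C" using R_cases[of x y] assms by auto
  then show "x \<in> D" using square_facts(5,6) by (auto simp: K_def)
qed

lemma C_source: "c \<in> C \<Longrightarrow> pclosed {c}"
  by (rule pclosed_C_subset) simp

lemma K_sink:
  assumes k: "k \<in> K" shows "pclosed (V - {k})"
  unfolding pclosed_def
proof (intro conjI allI impI)
  fix x y assume xy: "(x, y) \<in> R \<and> y \<in> V - {k}"
  then have "x \<in> C \<union> {u, v}" "x \<in> V" using R_cases[of x y] R_in_V[of x y] by auto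
  then show "x \<in> V - {k}" using k by (auto simp: K_def)
qed auto

lemma pclosed_CUV_Un:
  assumes "E \<subseteq> K" shows "pclosed (insert u (insert v C) \<union> E)"
  unfolding pclosed_def
proof (intro conjI allI impI)
  show "insert u (insert v C) \<union> E \<subseteq> V" using assms square_facts by (auto simp: K_def)
  fix x y assume "(x, y) \<in> R \<and> y \<in> insert u (insert v C) \<union> E"
  then show "x \<in> insert u (insert v C) \<union> E" using R_cases[of x y] by auto
qed

text \<open>Otherwise all predecessors of the sink \<open>k\<close> lie in \<open>C\<close>, so
  \<open>k\<close> can be added to all four sets. This flips all four values and keeps the square
  bad, but now an arc into \<open>k\<close> lies inside its bottom set.\<close>

lemma K_pred: "k \<in> K \<Longrightarrow> (u, k) \<in> R \<or> (v, k) \<in> R"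
proof (rule ccontr)
  assume k: "k \<in> K" and n: "\<not> ((u, k) \<in> R \<or> (v, k) \<in> R)"
  have kV: "k \<in> V" "k \<notin> C" "k \<noteq> u" "k \<noteq> v" using k by (auto simp: K_def)
  have pk: "x \<in> C" if "(x, k) \<in> R" for x using R_cases[OF that] n kV that by auto
  have cl: "pclosed (insert k C)"
    unfolding pclosed_def
  proof (intro conjI allI impI)
    show "insert k C \<subseteq> V" using kV square_facts(10) by simp
    fix x y assume "(x, y) \<in> R \<and> y \<in> insert k C"
    then show "x \<in> insert k C" using pk pclosedD[OF square_facts(1)] by blast
  qed
  have cl2: "pclosed (insert k Y)" if "pclosed Y" "C \<subseteq> Y" for Y
  proof -
    have "insert k C \<union> Y = insert k Y" using that(2) by auto
    then show ?thesis using pclosed_Un[OF cl that(1)] by simp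
  qed
  have par: "cut_par (insert k Y) \<longleftrightarrow> \<not> cut_par Y" if "pclosed Y" "C \<subseteq> Y" "k \<notin> Y" for Y
    using cut_par_sink[OF that(1) cl2[OF that(1,2)] K_sink[OF k] kV(1) that(3)] .
  have p: "cut_par (insert k C) \<longleftrightarrow> \<not> cut_par C"
    "cut_par (insert k (insert u C)) \<longleftrightarrow> \<not> cut_par (insert u C)"
    "cut_par (insert k (insert v C)) \<longleftrightarrow> \<not> cut_par (insert v C)"
    "cut_par (insert k (insert u (insert v C))) \<longleftrightarrow> \<not> cut_par (insert u (insert v C))"
    by (rule par; use square_facts kV in auto)+
  have q: "pclosed (insert k (insert u C))" "pclosed (insert k (insert v C))"
    by (rule cl2; use square_facts in auto)+
  have eq: "insert u (insert k C) = insert k (insert u C)" "insert v (insert k C) = insert k (insert v C)"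
    "insert u (insert k (insert v C)) = insert k (insert u (insert v C))" by auto
  have "bad_square (insert k C) u v"
    using bad cl q kV unfolding bad_square_def eq p by simp
  moreover obtain c where "adj k c" using ex_adj kV by blast
  then have "(c, k) \<in> R" using R_cases[of k c] k kV by (auto simp: adj_def)
  ultimately show False using bad_square_no_arcs(1)[of "insert k C" u v "(c, k)"] pk[of c] by simp
qed

text \<open>Dually, a source \<open>c\<close> preceding neither \<open>u\<close> nor
  \<open>v\<close> can be taken out of all four sets. The square stays bad, but an arc from
  \<open>c\<close> to \<open>K\<close> then lies outside its top set.\<close>

lemma C_succ: "c \<in> C \<Longrightarrow> (c, u) \<in> R \<or> (c, v) \<in> R"
proof (rule ccontr)
  assume c: "c \<in> C" and n: "\<not> ((c, u) \<in> R \<or> (c, v) \<in> R)"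
  define C' where "C' = C - {c}"
  have C': "insert c C' = C" "c \<notin> C'" "C' \<subseteq> C" using c by (auto simp: C'_def)
  have cl: "pclosed C'" by (rule pclosed_C_subset) (use C' in auto)
  have cuv: "c \<noteq> u" "c \<noteq> v" using c square_facts by auto
  have ins: "pclosed (insert a C')" if a: "pclosed (insert a C)" "(c, a) \<notin> R" "a \<notin> C" for a
    unfolding pclosed_def
  proof (intro conjI allI impI)
    show "insert a C' \<subseteq> V" using pclosed_subset[OF a(1)] C'(3) by auto
    fix x y assume xy: "(x, y) \<in> R \<and> y \<in> insert a C'"
    show "x \<in> insert a C'"
    proof (cases "y = a")
      case True
      then have "x \<in> insert a C" "x \<noteq> c" using pclosedD[OF a(1), of x y] xy a by auto
      then show ?thesis using C'(1) by auto
    next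
      case False
      then have "x \<in> C'" using pclosedD[OF cl, of x y] xy by auto
      then show ?thesis by simp
    qed
  qed
  have clu: "pclosed (insert u C')" and clv: "pclosed (insert v C')"
    using ins square_facts(2,3,5,6) n by auto
  have cluv: "pclosed (insert u (insert v C'))" using pclosed_insert_insert[OF clu clv] .
  have par: "cut_par (insert c Y) \<longleftrightarrow> \<not> cut_par Y" if "pclosed Y" "c \<notin> Y" for Y
    using cut_par_source[OF that(1) C_source[OF c] that(2)] .
  have eq: "insert u C = insert c (insert u C')" "insert v C = insert c (insert v C')"
    "insert u (insert c (insert v C')) = insert c (insert u (insert v C'))" "C = insert c C'"
    using C' by auto
  have p: "cut_par (insert c C') \<longleftrightarrow> \<not> cut_par C'"
    "cut_par (insert c (insert u C')) \<longleftrightarrow> \<not> cut_par (insert u C')"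
    "cut_par (insert c (insert v C')) \<longleftrightarrow> \<not> cut_par (insert v C')"
    "cut_par (insert c (insert u (insert v C'))) \<longleftrightarrow> \<not> cut_par (insert u (insert v C'))"
    by (rule par; use cl clu clv cluv C'(2) cuv in auto)+
  have "(cut_par C \<noteq> cut_par (insert u C)) \<noteq> (cut_par (insert v C) \<noteq> cut_par (insert u (insert v C)))"
    using bad by (simp add: bad_square_def)
  then have "(cut_par C' \<noteq> cut_par (insert u C')) \<noteq> (cut_par (insert v C') \<noteq> cut_par (insert u (insert v C')))"
    unfolding eq(1,2,3) p(2-4) using p(1)[unfolded C'(1)] by argo
  then have "bad_square C' u v"
    using cl clu clv C'(3) square_facts(5-7) unfolding bad_square_def by auto
  moreover obtain k where "adj c k" using ex_adj[of c] c square_facts(10) by blast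
  then have ck: "(c, k) \<in> R" "k \<in> K"
    using R_cases[of k c] R_cases[of c k] c n square_facts(5,6) by (auto simp: adj_def K_def)
  ultimately show False
    using bad_square_no_arcs(2)[of C' u v "(c, k)"] cuv C'(2,3) by (auto simp: K_def)
qed

lemma cut_par_C_subset: "D \<subseteq> C \<Longrightarrow> cut_par D \<longleftrightarrow> odd (card D)"
proof -
  assume D: "D \<subseteq> C"
  have "finite D" using D square_facts finite_V by (meson finite_subset)
  then show ?thesis using D
  proof (induction D rule: finite_induct)
    case (insert c D)
    then show ?case using cut_par_source[of D c] C_source[of c] pclosed_C_subset[of D] by auto
  qed (simp add: cut_par_empty)
qed

lemma cut_par_add_sources:
  assumes "pclosed Y" "D \<subseteq> C" "D \<inter> Y = {}"
  shows "cut_par (Y \<union> D) \<longleftrightarrow> cut_par Y \<noteq> odd (card D)"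
proof -
  have "finite D" using assms(2) square_facts finite_V by (meson finite_subset)
  then show ?thesis using assms(2,3)
  proof (induction D rule: finite_induct)
    case (insert c D)
    have "pclosed (Y \<union> D)" using pclosed_Un[OF assms(1) pclosed_C_subset] insert by auto
    then show ?case using cut_par_source[of "Y \<union> D" c] C_source[of c] insert by auto
  qed simp
qed

text \<open>Adding the sinks of \<open>K\<close> one by one flips the value each time and ends at
  \<open>V\<close>, where \<open>cut_par\<close> vanishes.\<close>

lemma cut_par_CUV: "cut_par (insert u (insert v C)) \<longleftrightarrow> odd (card K)"
proof -
  have *: "D \<subseteq> K \<Longrightarrow> cut_par (insert u (insert v C) \<union> D) \<longleftrightarrow> cut_par (insert u (insert v C)) \<noteq> odd (card D)"
    if "finite D" for D
    using that
  proof (induction D rule: finite_induct)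
    case (insert k D)
    have "cut_par (insert k (insert u (insert v C) \<union> D)) \<longleftrightarrow> \<not> cut_par (insert u (insert v C) \<union> D)"
      by (rule cut_par_sink) (use insert pclosed_CUV_Un[of D] pclosed_CUV_Un[of "insert k D"] K_sink[of k] in \<open>auto simp: K_def\<close>)
    then show ?case using insert by auto
  qed simp
  have "finite K" "insert u (insert v C) \<union> K = V" using finite_V square_facts by (auto simp: K_def)
  then show ?thesis using *[of K] cut_par_V by auto
qed

text \<open>The side at \<open>u\<close> is a star. Opposite it, \<open>v\<close> is adjacent to the
  remaining vertices of \<open>C\<close> and to its own successors. Any other sink \<open>k\<close>
  succeeds \<open>u\<close>; as \<open>u\<close> is no cut vertex, \<open>k\<close> has another
  predecessor, which lies in \<open>C\<close>, and by \<open>no_trans\<close> it does not precede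
  \<open>u\<close>, so it belongs to the star of \<open>v\<close>.\<close>

lemma bnd_down: "bnd (insert u {c \<in> C. (c, u) \<in> R})"
proof -
  define N where "N = {c \<in> C. (c, u) \<in> R}"
  have cl: "pclosed (insert u N)"
    unfolding pclosed_def
  proof (intro conjI allI impI)
    show "insert u N \<subseteq> V" using square_facts by (auto simp: N_def)
    fix x y assume "(x, y) \<in> R \<and> y \<in> insert u N"
    then show "x \<in> insert u N" using R_cases[of x y] square_facts(5-7) by (auto simp: N_def K_def)
  qed
  define A where "A = (C - N) \<union> {k \<in> K. (v, k) \<in> R}"
  define B where "B = {k \<in> K. (v, k) \<notin> R}"
  have cvA: "conn (insert v A)"
    by (rule conn_star) (use C_succ in \<open>auto simp: A_def N_def adj_def\<close>)
  have "conn (insert v A \<union> B)"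
  proof (rule conn_Un[OF cvA])
    fix k assume "k \<in> B"
    then have k: "k \<in> K" "(v, k) \<notin> R" "(u, k) \<in> R" using K_pred by (auto simp: B_def)
    have kV: "k \<in> V" "k \<noteq> u" "k \<noteq> v" using k by (auto simp: K_def)
    have "{k} \<subseteq> V - {u}" "{k} \<noteq> {}" "{k} \<noteq> V - {u}" using kV square_facts by auto
    then obtain x y where xy: "x \<in> {k}" "y \<in> V - {u} - {k}" "adj x y"
      using connD[OF conn_remove_vertex[OF square_facts(8)]] by metis
    then have yk: "(y, k) \<in> R" using R_cases[of k y] k kV by (auto simp: adj_def K_def)
    then have "y \<in> C" using R_cases[of y k] xy k by auto
    moreover have "(y, u) \<notin> R" using no_trans[of y u k] k yk by blast
    ultimately have "y \<in> A" by (auto simp: A_def N_def)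
    then show "\<exists>a\<in>insert v A. adj k a" using yk by (auto simp: adj_def)
  qed simp
  moreover have "insert v A \<union> B = V - insert u N"
    using square_facts by (auto simp: A_def B_def N_def K_def)
  moreover have "conn (insert u N)" by (rule conn_star) (auto simp: N_def adj_def)
  ultimately show ?thesis
    using cl square_facts unfolding bnd_def N_def[symmetric] by (auto simp: N_def)
qed

end

text \<open>The arc \<open>e = (c, u)\<close> is uncut by \<open>C - Cu\<close>, \<open>C - Cu + v\<close>, \<open>C + u\<close> and \<open>C + u + v\<close>, so \<open>T e\<close> forces
  \<open>cut_par\<close> to be modular on these four sets, which contradicts the parities on the bad square.\<close>

lemma bad_square_no_private:
  assumes bad: "bad_square C u v" and c: "c \<in> C"
  shows "(c, v) \<in> R"
proof (rule ccontr)
  assume n: "(c, v) \<notin> R"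
  note f = square_facts[OF bad]
  note bad' = bad_square_sym[OF bad]
  have cu: "(c, u) \<in> R" using C_succ[OF bad c] n by blast
  \<comment> \<open>By \<open>C_succ\<close>, \<open>Cu\<close> consists of the vertices of
    \<open>C\<close> preceding only \<open>u\<close> of the two hubs, and \<open>Cv\<close> of those
    preceding only \<open>v\<close>.\<close>
  define Cu where "Cu = {c \<in> C. (c, v) \<notin> R}"
  define Cv where "Cv = {c \<in> C. (c, u) \<notin> R}"
  define N where "N = insert u {c \<in> C. (c, u) \<in> R}"
  define N' where "N' = insert v {c \<in> C. (c, v) \<in> R}"
  have bN: "bnd N" "bnd N'" unfolding N_def N'_def using bnd_down[OF bad] bnd_down[OF bad'] .
  then have pN: "cut_par N" "cut_par N'" and clN: "pclosed N" "pclosed N'"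
    using cut_par_bnd by (auto simp: bnd_def)
  have e1: "insert u C = N \<union> Cv" "insert v C = N' \<union> Cu" "Cv \<inter> N = {}" "Cu \<inter> N' = {}"
    using f by (auto simp: N_def N'_def Cv_def Cu_def)
  \<comment> \<open>\<open>N\<close> is a bond side, so its value is odd, and every source of
    \<open>Cv\<close> flips it.\<close>
  have pu: "cut_par (insert u C) \<longleftrightarrow> even (card Cv)"
    using cut_par_add_sources[OF bad clN(1), of Cv] e1 pN by (auto simp: Cv_def)
  have pv: "cut_par (insert v C) \<longleftrightarrow> even (card Cu)"
    using cut_par_add_sources[OF bad clN(2), of Cu] e1 pN by (auto simp: Cu_def)
  have finC: "finite C" using f finite_V finite_subset by blast
  have cC: "card C = card (C - Cu) + card Cu"
  proof -
    have "Cu \<subseteq> C" "finite Cu" using finC by (auto simp: Cu_def)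
    then show ?thesis using finC by (simp add: card_Diff_subset card_mono)
  qed
  have pC: "cut_par C \<longleftrightarrow> odd (card C)" using cut_par_C_subset[OF bad, of C] by simp
  have pC': "cut_par (C - Cu) \<longleftrightarrow> odd (card (C - Cu))" using cut_par_C_subset[OF bad, of "C - Cu"] by auto
  note pK = cut_par_CUV[OF bad]
  define e where "e = (c, u)"
  have e: "e \<in> R" using cu by (simp add: e_def)
  have cCu: "c \<in> Cu" using c n by (simp add: Cu_def)
  have N'_eq: "N' = insert v (C - Cu)" by (auto simp: N'_def Cu_def)
  have un: "uncut e (C - Cu)" "uncut e N'" "uncut e (insert u C)" "uncut e (insert u (insert v C))"
    using f c cCu by (auto simp: uncut_def e_def N'_eq)
  have cl': "pclosed (C - Cu)" using pclosed_C_subset[OF bad] by auto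
  have t: "par (T e) (C - Cu) \<longleftrightarrow> odd (card (C - Cu))" "par (T e) N'"
    "par (T e) (insert u C) \<longleftrightarrow> even (card Cv)"
    "par (T e) (insert u (insert v C)) \<longleftrightarrow> odd (card (K C u v))"
    using cut_par_eq[OF cl' e un(1)] cut_par_eq[OF clN(2) e un(2)]
      cut_par_eq[OF f(2) e un(3)] cut_par_eq[OF f(4) e un(4)] pC' pN pu pK by auto
  have "par (T e) N' \<longleftrightarrow> par (T e) (C - Cu) \<noteq> (v \<in> T e)"
    unfolding N'_eq using par_insert[OF finite_T[OF e]] f by auto
  moreover have "par (T e) (insert v (insert u C)) \<longleftrightarrow> par (T e) (insert u C) \<noteq> (v \<in> T e)"
    using par_insert[OF finite_T[OF e]] f by auto
  \<comment> \<open>Eliminating \<open>v \<in> T e\<close> shows that the sizes of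
    \<open>C - Cu\<close>, \<open>K\<close> and \<open>Cv\<close> have an even sum, whereas the bad
    square makes this sum odd.\<close>
  ultimately have "odd (card (C - Cu)) \<noteq> odd (card (K C u v)) \<longleftrightarrow> odd (card Cv)"
    using t by (simp add: insert_commute) blast
  moreover have "(cut_par C \<noteq> cut_par (insert u C)) \<noteq> (cut_par (insert v C) \<noteq> cut_par (insert u (insert v C)))"
    using bad by (simp add: bad_square_def)
  ultimately show False unfolding pC pu pv pK using cC by auto
qed

text \<open>\<open>bad_square_no_private\<close>, used in both orders, joins all of \<open>C\<close>
  to both hubs, and then \<open>no_trans\<close> excludes arcs from \<open>C\<close> to
  \<open>K\<close>. A sink following one hub must follow the other too, since otherwise the first
  hub would be a cut vertex.\<close>

lemma diamond_case:
  obtains u v C K where "u \<noteq> v" "u \<notin> C \<union> K" "v \<notin> C \<union> K" "C \<inter> K = {}" "V = {u, v} \<union> C \<union> K"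
    "R = C \<times> {u, v} \<union> {u, v} \<times> K" "odd (card (C \<union> K))" "3 \<le> card (C \<union> K)"
proof -
  obtain C u v where bad: "bad_square C u v" using ex_bad_square by blast
  define L where "L = K C u v"
  note f = square_facts[OF bad]
  note L = K_def[OF bad, folded L_def]
  have Cuv: "(c, u) \<in> R" "(c, v) \<in> R" if "c \<in> C" for c
    using bad_square_no_private[OF bad that] bad_square_no_private[OF bad_square_sym[OF bad] that] by auto
  have Rc: "x \<in> C \<and> y \<in> {u, v} \<union> L \<or> x \<in> {u, v} \<and> y \<in> L" if "(x, y) \<in> R" for x y
    using R_cases[OF bad that] by (simp add: L_def)
  have Luv: "(u, k) \<in> R \<and> (v, k) \<in> R" if k: "k \<in> L" for k
  proof -
    have kV: "k \<in> V" "k \<noteq> u" "k \<noteq> v" "k \<notin> C" using k by (auto simp: L)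
    have noC: "(c, k) \<notin> R" if "c \<in> C" for c
      using K_pred[OF bad k[unfolded L_def]] Cuv[OF that] no_trans by blast
    have "(b, k) \<in> R" if ab: "a \<in> {u, v}" "b \<in> {u, v}" "a \<noteq> b" for a b
    proof -
      have "{k} \<subseteq> V - {a}" "{k} \<noteq> {}" "{k} \<noteq> V - {a}" using kV f ab by auto
      then obtain x y where xy: "x \<in> {k}" "y \<in> V - {a} - {k}" "adj x y"
        using connD[OF conn_remove_vertex[of a]] f ab by (metis empty_iff insert_iff)
      then have "(y, k) \<in> R" using Rc[of k y] kV by (auto simp: adj_def)
      then show ?thesis using Rc[of y k] noC xy k ab by (auto simp: L)
    qed
    then show ?thesis using f by blast
  qed
  have noCL: "(c, k) \<notin> R" if "c \<in> C" "k \<in> L" for c k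
    using Luv[OF that(2)] Cuv[OF that(1)] no_trans by blast
  have R: "R = C \<times> {u, v} \<union> {u, v} \<times> L"
  proof (intro equalityI subsetI)
    fix p assume "p \<in> R"
    then show "p \<in> C \<times> {u, v} \<union> {u, v} \<times> L" using Rc noCL by (cases p) blast
  next
    fix p assume "p \<in> C \<times> {u, v} \<union> {u, v} \<times> L"
    then show "p \<in> R" using Cuv Luv by auto
  qed
  have fin: "finite C" "finite L" using f finite_V finite_subset by (auto simp: L)
  have CL: "C \<inter> L = {}" by (auto simp: L)
  have pu: "cut_par (insert u C)" and pv: "cut_par (insert v C)"
  proof -
    have "{c \<in> C. (c, u) \<in> R} = C" "{c \<in> C. (c, v) \<in> R} = C" using Cuv by auto
    then show "cut_par (insert u C)" "cut_par (insert v C)"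
      using cut_par_bnd bnd_down[OF bad] bnd_down[OF bad_square_sym[OF bad]] by auto
  qed
  \<comment> \<open>The two middle sets are bond sides with odd value, so badness means that the
    bottom and top values differ. These are the parities of \<open>card C\<close> and
    \<open>card L\<close>.\<close>
  have "cut_par C \<noteq> cut_par (insert u (insert v C))"
    using bad pu pv by (simp add: bad_square_def)
  then have "odd (card C + card L)"
    using cut_par_C_subset[OF bad, of C] cut_par_CUV[OF bad] by (simp add: L_def)
  then have odd: "odd (card (C \<union> L))" using fin CL by (simp add: card_Un_disjoint)
  have Veq: "V = {u, v} \<union> C \<union> L" using f by (auto simp: L)
  have "card (C \<union> L) \<noteq> 1"
  proof
    assume "card (C \<union> L) = 1"
    then obtain x where x: "C \<union> L = {x}" using card_1_singletonE by blast
    have xn: "x \<noteq> u" "x \<noteq> v" "x \<in> V" using x f L by auto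
    then have "V - {x} = {u, v}" using Veq x by auto
    then have "conn {u, v}" using conn_remove_vertex[OF xn(3)] by simp
    then obtain a b where "a \<in> {u}" "b \<in> {u, v} - {u}" "adj a b"
      using connD[of "{u, v}" "{u}"] f by (metis insert_not_empty singleton_iff insert_iff empty_subsetI insert_subset)
    then have "adj u v" by auto
    then show False unfolding adj_def using Rc[of u v] Rc[of v u] f(5-7) unfolding L by blast
  qed
  with odd have "3 \<le> card (C \<union> L)" by presburger
  moreover have "u \<notin> C \<union> L" "v \<notin> C \<union> L" using f(5,6) by (simp_all add: L)
  ultimately show thesis using that[OF f(7) _ _ CL Veq R odd] by blast
qed

end

context critical_vertex_digraph
begin

theorem complete_bipartite_or_diamond:
  obtains (one_way) C where "C \<subseteq> V" "R = C \<times> (V - C)" "odd (card V)" "2 \<le> card C" "2 \<le> card (V - C)"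
  | (diamond) u v C K where "u \<noteq> v" "u \<notin> C \<union> K" "v \<notin> C \<union> K" "C \<inter> K = {}" "V = {u, v} \<union> C \<union> K"
    "R = C \<times> {u, v} \<union> {u, v} \<times> K" "odd (card (C \<union> K))" "3 \<le> card (C \<union> K)"
proof (cases "\<exists>C. pclosed C \<and> (\<forall>e\<in>R. \<not> uncut e C)")
  case True
  then show thesis using one_way_case one_way pclosed_subset by metis
next
  case False
  then interpret critical_mixed_vertex_digraph V R T by unfold_locales blast
  show thesis using diamond_case diamond by metis
qed

end

section \<open>Directed bonds under cut minor operations\<close>

lemma par_sym_diff_left:
  assumes "finite A" "finite B"
  shows "par (sym_diff A B) X \<longleftrightarrow> par A X \<noteq> par B X"
proof -
  let ?A = "A \<inter> X" and ?B = "B \<inter> X"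
  have fin: "finite ?A" "finite ?B" using assms by auto
  have "sym_diff A B \<inter> X = (?A - ?B) \<union> (?B - ?A)" by auto
  also have "card \<dots> = card (?A - ?B) + card (?B - ?A)"
    using fin by (intro card_Un_disjoint) auto
  finally have "card (sym_diff A B \<inter> X) = card (?A - ?B) + card (?B - ?A)" .
  moreover have "card ?A = card (?A - ?B) + card (?A \<inter> ?B)" "card ?B = card (?B - ?A) + card (?A \<inter> ?B)"
    using card_Int_Diff[OF fin(1), of ?B] card_Int_Diff[OF fin(2), of ?A] by (simp_all add: Int_commute)
  ultimately show ?thesis unfolding par_def by presburger
qed

lemma par_sym_diff_right:
  assumes "finite J"
  shows "par J (sym_diff A B) \<longleftrightarrow> par J A \<noteq> par J B"
proof -
  have "par J (sym_diff A B) = par (sym_diff (J \<inter> A) (J \<inter> B)) UNIV"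
    unfolding par_def by (intro arg_cong[where f = "\<lambda>S. odd (card S)"]) auto
  also have "\<dots> \<longleftrightarrow> par (J \<inter> A) UNIV \<noteq> par (J \<inter> B) UNIV"
    using assms by (intro par_sym_diff_left) auto
  finally show ?thesis by (simp add: par_def)
qed

lemma odd_dijoin_iff:
  "odd_dijoin G J \<longleftrightarrow> J \<subseteq> arcs G \<and> (\<forall>S. directed_bond G S \<longrightarrow> par J S)"
  by (simp add: odd_dijoin_def par_def)

text \<open>A cut given by one side, which may be any set. Preimages under the vertex map of a
  contraction can therefore be used without restricting them to vertices.\<close>

definition boundary :: "('a, 'b) pre_digraph \<Rightarrow> 'a set \<Rightarrow> 'b set" where
  "boundary G X = {e \<in> arcs G. (tail G e \<in> X) \<noteq> (head G e \<in> X)}"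

definition in_closed :: "('a, 'b) pre_digraph \<Rightarrow> 'a set \<Rightarrow> bool" where
  "in_closed G X \<longleftrightarrow> (\<forall>e\<in>arcs G. head G e \<in> X \<longrightarrow> tail G e \<in> X)"

context wf_digraph
begin

lemma cut_between_eq_boundary:
  assumes "vertex_bipartition G X Y" shows "cut_between G X Y = boundary G X"
  using assms wellformed unfolding vertex_bipartition_def cut_between_def boundary_def by blast

lemma boundary_Int_verts: "boundary G (X \<inter> verts G) = boundary G X"
  by (auto simp: boundary_def)

lemma is_cut_iff: "is_cut G S \<longleftrightarrow> (\<exists>X. S = boundary G X)"
proof
  assume "is_cut G S"
  then show "\<exists>X. S = boundary G X" unfolding is_cut_def using cut_between_eq_boundary by blast
next
  assume "\<exists>X. S = boundary G X"
  then obtain X where X: "S = boundary G X" by blast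
  have "vertex_bipartition G (X \<inter> verts G) (verts G - X)" by (auto simp: vertex_bipartition_def)
  then show "is_cut G S" unfolding is_cut_def X
    using cut_between_eq_boundary boundary_Int_verts by metis
qed

lemma directed_bond_iff:
  "directed_bond G S \<longleftrightarrow> bond G S \<and> (\<exists>X. S = boundary G X \<and> in_closed G X)"
proof
  assume A: "directed_bond G S"
  then obtain X Y where XY: "vertex_bipartition G X Y" "S = cut_between G X Y"
    "\<not> (\<exists>e \<in> arcs G. tail G e \<in> Y \<and> head G e \<in> X)" unfolding directed_bond_def by blast
  then have "in_closed G X" using wellformed unfolding in_closed_def vertex_bipartition_def by blast
  with A XY show "bond G S \<and> (\<exists>X. S = boundary G X \<and> in_closed G X)"
    using cut_between_eq_boundary by (auto simp: directed_bond_def)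
next
  assume "bond G S \<and> (\<exists>X. S = boundary G X \<and> in_closed G X)"
  then obtain X where X: "bond G S" "S = boundary G X" "in_closed G X" by blast
  have bp: "vertex_bipartition G (X \<inter> verts G) (verts G - X)" by (auto simp: vertex_bipartition_def)
  moreover have "S = cut_between G (X \<inter> verts G) (verts G - X)"
    using cut_between_eq_boundary[OF bp] boundary_Int_verts X(2) by simp
  moreover have "\<not> (\<exists>e \<in> arcs G. tail G e \<in> verts G - X \<and> head G e \<in> X \<inter> verts G)"
    using X(3) by (auto simp: in_closed_def)
  ultimately show "directed_bond G S" using X(1) unfolding directed_bond_def by blast
qed

lemma bondI:
  assumes "S = boundary G X" "S \<noteq> {}"
    and "\<And>Z. boundary G Z \<noteq> {} \<Longrightarrow> boundary G Z \<subseteq> S \<Longrightarrow> S \<subseteq> boundary G Z"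
  shows "bond G S"
  using assms unfolding bond_def is_cut_iff by blast

lemma bondD:
  assumes "bond G S"
  shows "S \<noteq> {}" "\<exists>X. S = boundary G X" "\<And>Z. boundary G Z \<noteq> {} \<Longrightarrow> boundary G Z \<subseteq> S \<Longrightarrow> boundary G Z = S"
  using assms unfolding bond_def is_cut_iff by blast+

section \<open>Contraction of a single arc\<close>

lemma weak_component_single:
  assumes e: "e \<in> arcs G" and v: "v \<in> verts G"
  shows "weak_component G {e} v = (if v \<in> {tail G e, head G e} then {tail G e, head G e} else {v})"
proof -
  let ?H = "with_proj (mk_symmetric (G\<lparr>arcs := {e}\<rparr>))"
  have ends: "arcs_ends ?H = {(tail G e, head G e), (head G e, tail G e)}"
    by (auto simp: arcs_ends_conv parcs_mk_symmetric)
  interpret H: wf_digraph ?H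
    by unfold_locales (use e in \<open>auto simp: parcs_mk_symmetric\<close>)
  have vH: "v \<in> verts ?H" using v by simp
  have "weak_component G {e} v = {u. (v, u) \<in> {(tail G e, head G e), (head G e, tail G e)}\<^sup>*}"
    by (simp only: weak_component_def H.reachable_conv'[OF vH] ends)
  moreover have "(v, u) \<in> {(tail G e, head G e), (head G e, tail G e)}\<^sup>* \<longleftrightarrow>
      u \<in> (if v \<in> {tail G e, head G e} then {tail G e, head G e} else {v})" (is "?L \<longleftrightarrow> ?R") for u
  proof
    assume ?L
    then show ?R by induction auto
  next
    assume ?R
    then show ?L by (auto split: if_splits)
  qed
  ultimately show ?thesis by auto
qed

text \<open>The representative of \<open>v\<close> is \<open>v\<close> itself or an end of
  \<open>e\<close>, and it is never separated from \<open>v\<close> by a set that contains both ends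
  or neither.\<close>

lemma contract_vert_mem_iff:
  assumes e: "e \<in> arcs G" and v: "v \<in> verts G" and X: "tail G e \<in> X \<longleftrightarrow> head G e \<in> X"
  shows "contract_vert G {e} v \<in> X \<longleftrightarrow> v \<in> X"
proof -
  have "contract_vert G {e} v \<in> weak_component G {e} v"
    unfolding contract_vert_def weak_component_single[OF e v] by (rule someI[of _ v]) auto
  then show ?thesis using X unfolding weak_component_single[OF e v] by (auto split: if_splits)
qed

lemma contract_vert_ends:
  assumes "e \<in> arcs G" shows "contract_vert G {e} (tail G e) = contract_vert G {e} (head G e)"
  using weak_component_single[OF assms, of "tail G e"] weak_component_single[OF assms, of "head G e"] assms
  by (simp add: contract_vert_def)

lemma wf_digraph_contract: "wf_digraph (contract G A)"
  by unfold_locales (auto simp: contract_def)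

lemma boundary_contract:
  assumes e: "e \<in> arcs G"
  shows "boundary (contract G {e}) X = boundary G (contract_vert G {e} -` X)"
    and "e \<notin> boundary G (contract_vert G {e} -` X)"
  using contract_vert_ends[OF e] by (auto simp: boundary_def contract_def)

lemma boundary_contract_uncut:
  assumes e: "e \<in> arcs G" and X: "e \<notin> boundary G X"
  shows "boundary (contract G {e}) X = boundary G X"
proof -
  have "tail G e \<in> X \<longleftrightarrow> head G e \<in> X" using X e by (auto simp: boundary_def)
  then show ?thesis
    unfolding boundary_contract(1)[OF e]
    using contract_vert_mem_iff[OF e] by (auto simp: boundary_def)
qed

text \<open>A cut of the contraction pulls back along the vertex map to a cut avoiding
  \<open>e\<close>. Conversely, a set that does not separate the ends of \<open>e\<close> has the
  same cut in both digraphs.\<close>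

lemma cut_contract_iff:
  assumes e: "e \<in> arcs G"
  shows "is_cut (contract G {e}) S \<longleftrightarrow> is_cut G S \<and> e \<notin> S"
  unfolding is_cut_iff wf_digraph.is_cut_iff[OF wf_digraph_contract]
  using boundary_contract[OF e] boundary_contract_uncut[OF e] by metis

lemma bond_contract_iff:
  assumes e: "e \<in> arcs G"
  shows "bond (contract G {e}) S \<longleftrightarrow> bond G S \<and> e \<notin> S"
  unfolding bond_def cut_contract_iff[OF e] by blast

lemma directed_bond_contract_iff:
  assumes e: "e \<in> arcs G"
  shows "directed_bond (contract G {e}) S \<longleftrightarrow> directed_bond G S \<and> e \<notin> S"
proof -
  let ?p = "contract_vert G {e}"
  have cl1: "in_closed G (?p -` X)" if "in_closed (contract G {e}) X" for X
    using that contract_vert_ends[OF e] by (auto simp: in_closed_def contract_def)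
  have cl2: "in_closed (contract G {e}) X" if "in_closed G X" "e \<notin> boundary G X" for X
  proof -
    have "tail G e \<in> X \<longleftrightarrow> head G e \<in> X" using that e by (auto simp: boundary_def)
    then show ?thesis using that contract_vert_mem_iff[OF e] by (auto simp: in_closed_def contract_def)
  qed
  have "(\<exists>X. S = boundary (contract G {e}) X \<and> in_closed (contract G {e}) X) \<longleftrightarrow>
      (\<exists>X. S = boundary G X \<and> in_closed G X) \<and> e \<notin> S" (is "?L \<longleftrightarrow> ?R")
  proof
    assume ?L
    then show ?R using boundary_contract[OF e] cl1 by blast
  next
    assume ?R
    then show ?L using boundary_contract_uncut[OF e] cl2 by blast
  qed
  then show ?thesis
    unfolding directed_bond_iff wf_digraph.directed_bond_iff[OF wf_digraph_contract] bond_contract_iff[OF e]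
    by blast
qed

section \<open>Deletion of deletable arcs and isolated vertices\<close>

lemma boundary_del_arc: "boundary (del_arc e) X = boundary G X - {e}"
  by (auto simp: boundary_def)

text \<open>Each crossing switches sides, so the number of crossings is odd exactly when the ends
  lie on different sides.\<close>

lemma par_walk_boundary:
  assumes "cas u p v" "distinct p" "set p \<subseteq> arcs G"
  shows "par (set p) (boundary G Z) \<longleftrightarrow> (u \<in> Z) \<noteq> (v \<in> Z)"
  using assms
proof (induction p arbitrary: u)
  case Nil
  then show ?case by (simp add: par_def)
next
  case (Cons e es)
  then have IH: "par (set es) (boundary G Z) \<longleftrightarrow> (head G e \<in> Z) \<noteq> (v \<in> Z)" by auto
  have "set (e # es) = sym_diff {e} (set es)" using Cons.prems by auto
  then have "par (set (e # es)) (boundary G Z) \<longleftrightarrow> par {e} (boundary G Z) \<noteq> par (set es) (boundary G Z)"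
    using par_sym_diff_left[of "{e}" "set es"] by simp
  moreover have "par {e} (boundary G Z) \<longleftrightarrow> e \<in> boundary G Z" by simp
  moreover have "e \<in> boundary G Z \<longleftrightarrow> (u \<in> Z) \<noteq> (head G e \<in> Z)" using Cons.prems by (auto simp: boundary_def)
  ultimately show ?case using IH by blast
qed

lemma walk_in_closed:
  assumes "cas u p v" "set p \<subseteq> arcs G" "in_closed G X" "v \<in> X"
  shows "u \<in> X"
  using assms by (induction p arbitrary: u) (auto simp: in_closed_def)

text \<open>A directed walk that leaves a closed set never returns, so one with both ends on the
  same side does not cross at all.\<close>

lemma walk_disjoint_boundary:
  assumes "cas u p v" "set p \<subseteq> arcs G" "in_closed G X" "u \<in> X \<longleftrightarrow> v \<in> X"
  shows "set p \<inter> boundary G X = {}"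
  using assms
proof (induction p arbitrary: u)
  case (Cons e es)
  have cas: "cas (head G e) es v" "set es \<subseteq> arcs G" "tail G e = u" "e \<in> arcs G" using Cons.prems by auto
  have "head G e \<in> X \<longleftrightarrow> v \<in> X"
    using walk_in_closed[OF cas(1,2) Cons.prems(3)] Cons.prems(3,4) cas by (auto simp: in_closed_def)
  then show ?case using Cons.IH[OF cas(1,2) Cons.prems(3)] Cons.prems(4) cas by (auto simp: boundary_def)
qed simp

lemma deletableE:
  assumes "deletable G e"
  obtains p where "e \<in> arcs G" "cas (tail G e) p (head G e)" "distinct p" "set p \<subseteq> arcs G" "e \<notin> set p"
proof -
  obtain p where p: "apath (tail G e) p (head G e)" "e \<notin> set p" "e \<in> arcs G"
    using assms unfolding deletable_def by blast
  then have "distinct (map (tail G) p)"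
    unfolding apath_def awalk_verts_conv by (auto split: if_splits)
  then have "distinct p" by (simp add: distinct_map)
  then show thesis using that p by (auto simp: apath_def awalk_def)
qed

text \<open>The path \<open>p\<close> closes with \<open>e\<close> to a cycle, so every cut through
  \<open>e\<close> contains another arc of it and stays nonempty. A directed cut missing
  \<open>e\<close> also misses \<open>p\<close>, so a cut contained in it after deletion was
  contained in it before.\<close>

lemma directed_bond_del_arc:
  assumes del: "deletable G e" and S: "directed_bond G S"
  shows "directed_bond (del_arc e) (S - {e})"
proof -
  obtain p where p: "e \<in> arcs G" "cas (tail G e) p (head G e)" "distinct p" "set p \<subseteq> arcs G" "e \<notin> set p"
    using deletableE[OF del] .
  obtain X where X: "bond G S" "S = boundary G X" "in_closed G X" using S directed_bond_iff by blast
  interpret D: wf_digraph "del_arc e" by (rule wf_digraph_del_arc)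
  have cross: "set p \<inter> boundary G Z \<noteq> {}" if "e \<in> boundary G Z" for Z
    using par_walk_boundary[OF p(2-4), of Z] that by (auto simp: boundary_def par_def)
  have none: "set p \<inter> S = {}" if "e \<notin> S"
    using walk_disjoint_boundary[OF p(2,4) X(3)] that p(1) X(2) by (auto simp: boundary_def)
  have "bond (del_arc e) (S - {e})"
  proof (rule D.bondI)
    show "S - {e} = boundary (del_arc e) X" using boundary_del_arc X by simp
    show "S - {e} \<noteq> {}" using cross[of X] bondD(1)[OF X(1)] X(2) p(5) by blast
    fix Z assume Z: "boundary (del_arc e) Z \<noteq> {}" "boundary (del_arc e) Z \<subseteq> S - {e}"
    then have Z': "boundary G Z - {e} \<subseteq> S - {e}" "boundary G Z \<noteq> {}" by (auto simp: boundary_del_arc)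
    have "e \<in> S" if "e \<in> boundary G Z"
      using cross[OF that] none Z' p(5) by blast
    then have "boundary G Z \<subseteq> S" using Z' by blast
    then have "boundary G Z = S" using bondD(3)[OF X(1)] Z' by blast
    then show "S - {e} \<subseteq> boundary (del_arc e) Z" by (simp add: boundary_del_arc)
  qed
  moreover have "in_closed (del_arc e) X" using X by (auto simp: in_closed_def)
  moreover have "S - {e} = boundary (del_arc e) X" by (simp add: boundary_del_arc X(2))
  ultimately show ?thesis unfolding D.directed_bond_iff by blast
qed

text \<open>Walking along \<open>p\<close> shows that the tail side stays closed when
  \<open>e\<close> is put back. Whether \<open>e\<close> belongs to a cut is determined by the
  parity of the cut on \<open>p\<close>, hence by its other arcs, so minimality survives.\<close>

lemma directed_bond_del_arcE:
  assumes del: "deletable G e" and S': "directed_bond (del_arc e) S'"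
  obtains S where "directed_bond G S" "S' = S - {e}"
proof -
  obtain p where p: "e \<in> arcs G" "cas (tail G e) p (head G e)" "distinct p" "set p \<subseteq> arcs G" "e \<notin> set p"
    using deletableE[OF del] .
  interpret D: wf_digraph "del_arc e" by (rule wf_digraph_del_arc)
  obtain X where X: "bond (del_arc e) S'" "S' = boundary (del_arc e) X" "in_closed (del_arc e) X"
    using S' D.directed_bond_iff by blast
  have Dcas: "pre_digraph.cas (del_arc e) u q v = cas u q v" for u q v
    by (induction q arbitrary: u) (auto simp: pre_digraph.cas.simps)
  have clG: "in_closed G X"
  proof -
    have "tail G e \<in> X" if "head G e \<in> X"
      using D.walk_in_closed[of "tail G e" p "head G e" X] Dcas p that X(3) by auto
    then show ?thesis using X(3) by (auto simp: in_closed_def)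
  qed
  define S where "S = boundary G X"
  have SS': "S' = S - {e}" using X(2) by (simp add: S_def boundary_del_arc)
  have par_iff: "e \<in> boundary G Z \<longleftrightarrow> par (set p) (boundary G Z - {e})" for Z
  proof -
    have "set p \<inter> (boundary G Z - {e}) = set p \<inter> boundary G Z" using p(5) by auto
    then show ?thesis using par_walk_boundary[OF p(2-4), of Z] p(1) by (auto simp: boundary_def par_def)
  qed
  have "bond G S"
  proof (rule bondI)
    show "S = boundary G X" by (simp add: S_def)
    show "S \<noteq> {}" using SS' D.bondD(1)[OF X(1)] by auto
    fix Z assume Z: "boundary G Z \<noteq> {}" "boundary G Z \<subseteq> S"
    have "boundary G Z - {e} \<noteq> {}"
    proof
      assume *: "boundary G Z - {e} = {}"
      then have "e \<notin> boundary G Z" unfolding par_iff[of Z] * by simp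
      with * Z(1) show False by blast
    qed
    moreover have "boundary G Z - {e} \<subseteq> S'" using Z(2) SS' by blast
    ultimately have eq: "boundary G Z - {e} = S'"
      using D.bondD(3)[OF X(1), of Z] unfolding boundary_del_arc by blast
    have "e \<in> boundary G Z \<longleftrightarrow> e \<in> S"
      unfolding S_def par_iff[of Z] par_iff[of X] unfolding eq using SS' by (simp add: S_def)
    then show "S \<subseteq> boundary G Z" using eq SS' by blast
  qed
  then have "directed_bond G S" unfolding directed_bond_iff using clG S_def by blast
  then show thesis using that SS' by blast
qed

lemma directed_bond_del_vert:
  assumes "isolated G v"
  shows "directed_bond (del_vert v) S \<longleftrightarrow> directed_bond G S"
proof -
  have arcs: "arcs (del_vert v) = arcs G"
    using assms by (auto simp: del_vert_simps isolated_def in_arcs_def out_arcs_def)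
  have b: "boundary (del_vert v) = boundary G" "in_closed (del_vert v) = in_closed G"
    using arcs by (auto simp: boundary_def in_closed_def del_vert_simps fun_eq_iff)
  interpret D: wf_digraph "del_vert v" by (rule wf_digraph_del_vert)
  show ?thesis
    unfolding D.directed_bond_iff directed_bond_iff bond_def D.is_cut_iff is_cut_iff b ..
qed

end

section \<open>Inheritance of odd dijoins by cut minors\<close>

context fin_digraph
begin

lemma fin_digraph_contract: "fin_digraph (contract G A)"
proof -
  interpret C: wf_digraph "contract G A" by (rule wf_digraph_contract)
  show ?thesis by unfold_locales (auto simp: contract_def)
qed

lemma odd_dijoin_contract:
  assumes "e \<in> arcs G" "odd_dijoin G J"
  shows "odd_dijoin (contract G {e}) (J - {e})"
  unfolding odd_dijoin_iff
proof (intro conjI allI impI)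
  show "J - {e} \<subseteq> arcs (contract G {e})" using assms by (auto simp: odd_dijoin_def contract_def)
  fix S assume "directed_bond (contract G {e}) S"
  then have "directed_bond G S" "e \<notin> S" using directed_bond_contract_iff[OF assms(1)] by auto
  then have "par J S" "(J - {e}) \<inter> S = J \<inter> S" using assms(2) by (auto simp: odd_dijoin_iff)
  then show "par (J - {e}) S" by (simp add: par_def)
qed

lemma odd_dijoin_del_arc:
  assumes del: "deletable G e" and J: "odd_dijoin G J"
  shows "\<exists>J'. odd_dijoin (del_arc e) J'"
proof -
  obtain p where p: "e \<in> arcs G" "cas (tail G e) p (head G e)" "distinct p" "set p \<subseteq> arcs G" "e \<notin> set p"
    using deletableE[OF del] .
  have finJ: "finite J" using J by (auto simp: odd_dijoin_def intro: finite_subset[OF _ finite_arcs])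
  \<comment> \<open>The path closes with \<open>e\<close> to a cycle, which meets every cut evenly.\<close>
  define J' where "J' = (if e \<in> J then sym_diff J (insert e (set p)) else J)"
  have eJ': "e \<notin> J'" by (auto simp: J'_def)
  have sub: "J' \<subseteq> arcs G" using J p by (auto simp: J'_def odd_dijoin_def)
  have cyc: "\<not> par (insert e (set p)) (boundary G X)" for X
  proof -
    have "insert e (set p) = sym_diff {e} (set p)" using p(5) by auto
    then have "par (insert e (set p)) (boundary G X) \<longleftrightarrow> par {e} (boundary G X) \<noteq> par (set p) (boundary G X)"
      using par_sym_diff_left[of "{e}" "set p"] by simp
    moreover have "par {e} (boundary G X) \<longleftrightarrow> e \<in> boundary G X" by simp
    ultimately show ?thesis using par_walk_boundary[OF p(2-4), of X] p(1) by (auto simp: boundary_def)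
  qed
  have "par J' S'" if S': "directed_bond (del_arc e) S'" for S'
  proof -
    obtain S where S: "directed_bond G S" "S' = S - {e}" using directed_bond_del_arcE[OF del S'] .
    then obtain X where X: "S = boundary G X" using directed_bond_iff by blast
    have "par J S" using J S by (auto simp: odd_dijoin_iff)
    then have "par J' S"
      using par_sym_diff_left[OF finJ, of "insert e (set p)" S] cyc[of X] X by (auto simp: J'_def)
    moreover have "J' \<inter> S' = J' \<inter> S" using eJ' S by auto
    ultimately show ?thesis by (simp add: par_def)
  qed
  then have "odd_dijoin (del_arc e) J'" using sub eJ' by (auto simp: odd_dijoin_iff)
  then show ?thesis by blast
qed

text \<open>Restoring \<open>e\<close> does not change how a dijoin avoiding \<open>e\<close> meets
  a bond. This is the direction that excludes deletable arcs from a minimal counterexample.\<close>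

lemma odd_dijoin_del_arcD:
  assumes "deletable G e" "odd_dijoin (del_arc e) J"
  shows "odd_dijoin G J"
  unfolding odd_dijoin_iff
proof (intro conjI allI impI)
  show "J \<subseteq> arcs G" using assms(2) by (auto simp: odd_dijoin_def)
  fix S assume "directed_bond G S"
  then have "par J (S - {e})"
    using directed_bond_del_arc[OF assms(1)] assms(2) by (auto simp: odd_dijoin_iff)
  moreover have "J \<inter> (S - {e}) = J \<inter> S" using assms(2) by (auto simp: odd_dijoin_def)
  ultimately show "par J S" by (simp add: par_def)
qed

lemma odd_dijoin_del_vert_iff:
  assumes "isolated G v" shows "odd_dijoin (del_vert v) J \<longleftrightarrow> odd_dijoin G J"
proof -
  have "arcs (del_vert v) = arcs G"
    using assms by (auto simp: del_vert_simps isolated_def in_arcs_def out_arcs_def)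
  then show ?thesis using directed_bond_del_vert[OF assms] by (simp add: odd_dijoin_iff)
qed

end

lemma cut_minor_fin_digraph:
  assumes "cut_minor D H" "fin_digraph D" shows "fin_digraph H"
  using assms
  by induction (auto intro: fin_digraph.fin_digraph_contract fin_digraph.fin_digraph_del_arc
      fin_digraph.fin_digraph_del_vert)

lemma cut_minor_odd_dijoin:
  assumes "cut_minor D H" "fin_digraph D" "odd_dijoin D J"
  shows "\<exists>J'. odd_dijoin H J'"
  using assms
proof induction
  case (contract_arc H e)
  then obtain J' where "odd_dijoin H J'" by blast
  then show ?case
    using fin_digraph.odd_dijoin_contract[OF cut_minor_fin_digraph[OF contract_arc.hyps(1) contract_arc.prems(1)] contract_arc.hyps(2)] by blast
next
  case (delete_arc H e)
  then obtain J' where "odd_dijoin H J'" by blast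
  then show ?case
    using fin_digraph.odd_dijoin_del_arc[OF cut_minor_fin_digraph[OF delete_arc.hyps(1) delete_arc.prems(1)] delete_arc.hyps(2)] by blast
next
  case (delete_vert H v)
  then obtain J' where "odd_dijoin H J'" by blast
  then show ?case
    using fin_digraph.odd_dijoin_del_vert_iff[OF cut_minor_fin_digraph[OF delete_vert.hyps(1) delete_vert.prems(1)] delete_vert.hyps(2)] by blast
qed blast

section \<open>From arc sets to vertex sets and back\<close>

context vertex_digraph
begin

lemma conn_complete_bipartite:
  assumes R: "R = C \<times> (V - C)" and A: "A \<subseteq> C" "A \<noteq> {}" and B: "B \<subseteq> V - C" "B \<noteq> {}"
  shows "conn (A \<union> B)"
proof -
  have R': "(x, y) \<in> R \<longleftrightarrow> x \<in> C \<and> y \<in> V - C" for x y using R by simp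
  obtain a where a: "a \<in> A" using A by auto
  have "conn (insert a B)" by (rule conn_star) (use a A B in \<open>auto simp: adj_def R'\<close>)
  then have "conn (insert a B \<union> A)"
    by (rule conn_Un) (use A B in \<open>auto simp: adj_def R'\<close>)
  moreover have "insert a B \<union> A = A \<union> B" using a by auto
  ultimately show ?thesis by simp
qed

lemma complete_bipartite_conn:
  assumes R: "R = C \<times> (V - C)" and C: "C \<subseteq> V" "2 \<le> card C" "2 \<le> card (V - C)"
  shows "conn V"
proof -
  have "C \<noteq> {}" "V - C \<noteq> {}" using C(2,3) by force+
  then have "conn (C \<union> (V - C))" using conn_complete_bipartite[OF R, of C "V - C"] by simp
  moreover have "C \<union> (V - C) = V" using C by auto
  ultimately show ?thesis by simp
qed

text \<open>Each source, and the complement of each sink, is a bond side, which forces every vertex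
  into \<open>S\<close>. So \<open>card V\<close> equals the even \<open>card S\<close>.\<close>

lemma complete_bipartite_even:
  assumes R: "R = C \<times> (V - C)" and C: "C \<subseteq> V" "2 \<le> card C" "2 \<le> card (V - C)"
    and S: "S \<subseteq> V" "even (card S)" "\<And>X. bnd X \<Longrightarrow> par S X"
  shows "even (card V)"
proof -
  have other: "\<exists>y\<in>A. y \<noteq> x" if "2 \<le> card A" for A :: "'a set" and x
  proof (rule ccontr)
    assume "\<not> ?thesis"
    then have "A \<subseteq> {x}" by blast
    then have "card A \<le> card {x}" by (intro card_mono) auto
    then show False using that by simp
  qed
  note conn = conn_complete_bipartite[OF R]
  have R': "(x, y) \<in> R \<longleftrightarrow> x \<in> C \<and> y \<in> V - C" for x y using R by simp
  have Cne: "C \<noteq> {}" "V - C \<noteq> {}" using C by force+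
  have "C \<subseteq> S"
  proof
    fix c assume c: "c \<in> C"
    obtain c' where c': "c' \<in> C" "c' \<noteq> c" using other[OF C(2)] by blast
    have "conn ((C - {c}) \<union> (V - C))" using conn[of "C - {c}" "V - C"] c' Cne by auto
    moreover have "(C - {c}) \<union> (V - C) = V - {c}" using c C by auto
    ultimately have "bnd {c}" using c c' C by (auto simp: bnd_def pclosed_def R')
    then show "c \<in> S" using S(3) by fastforce
  qed
  moreover have "V - C \<subseteq> S"
  proof
    fix k assume k: "k \<in> V - C"
    obtain k' where k': "k' \<in> V - C" "k' \<noteq> k" using other[OF C(3)] by blast
    have "conn (C \<union> (V - C - {k}))" using conn[of C "V - C - {k}"] k' Cne by auto
    moreover have "C \<union> (V - C - {k}) = V - {k}" "V - (V - {k}) = {k}" using k C by auto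
    moreover have "pclosed (V - {k})" using k C by (auto simp: pclosed_def R')
    ultimately have "bnd (V - {k})" using k k' by (auto simp: bnd_def)
    then have "par S (V - {k})" using S(3) by blast
    then show "k \<in> S" using par_Diff[OF finite_V S(1,2), of "{k}"] k by simp
  qed
  ultimately have "S = V" using S(1) by blast
  then show "even (card V)" using S(2) by simp
qed

lemma conn_diamond:
  assumes R: "R = C \<times> {u, v} \<union> {u, v} \<times> K" and A: "A \<subseteq> C \<union> K" "A \<noteq> {}"
  shows "conn ({u, v} \<union> A)"
proof -
  have R': "(x, y) \<in> R \<longleftrightarrow> x \<in> C \<and> y \<in> {u, v} \<or> x \<in> {u, v} \<and> y \<in> K" for x y using R by simp
  have "conn (insert u A)" by (rule conn_star) (use A in \<open>auto simp: adj_def R'\<close>)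
  then have "conn (insert u A \<union> {v})" by (rule conn_Un) (use A in \<open>auto simp: adj_def R'\<close>)
  moreover have "insert u A \<union> {v} = {u, v} \<union> A" by auto
  ultimately show ?thesis by simp
qed

lemma diamond_conn:
  assumes R: "R = C \<times> {u, v} \<union> {u, v} \<times> K" and V: "V = {u, v} \<union> C \<union> K"
    and "2 \<le> card (C \<union> K)"
  shows "conn V"
proof -
  have "C \<union> K \<noteq> {}" using assms(3) by force
  then show ?thesis using conn_diamond[OF R, of "C \<union> K"] V by (simp add: Un_assoc)
qed

text \<open>Sources and sinks are forced into \<open>S\<close> as in the bipartite case. The bonds
  at \<open>C + u\<close> and \<open>C + v\<close> force \<open>u\<close> and \<open>v\<close> to be
  both inside or both outside \<open>S\<close>, so \<open>card V\<close> has the parity of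
  \<open>card S\<close>.\<close>

lemma diamond_even:
  assumes R: "R = C \<times> {u, v} \<union> {u, v} \<times> K" and V: "V = {u, v} \<union> C \<union> K"
    and d: "u \<noteq> v" "u \<notin> C \<union> K" "v \<notin> C \<union> K" "C \<inter> K = {}" "2 \<le> card (C \<union> K)"
    and S: "S \<subseteq> V" "even (card S)" "\<And>X. bnd X \<Longrightarrow> par S X"
  shows "even (card V)"
proof -
  have finS: "finite S" using S(1) finite_V finite_subset by blast
  note conn = conn_diamond[OF R]
  have R': "(x, y) \<in> R \<longleftrightarrow> x \<in> C \<and> y \<in> {u, v} \<or> x \<in> {u, v} \<and> y \<in> K" for x y using R by simp
  have other: "C \<union> K - {z} \<noteq> {}" for z
  proof
    assume "C \<union> K - {z} = {}"
    then have "card (C \<union> K) \<le> card {z}" by (intro card_mono) auto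
    then show False using d(5) by simp
  qed
  have sub: "C \<union> K \<subseteq> S"
  proof
    fix z assume z: "z \<in> C \<union> K"
    have "conn ({u, v} \<union> (C \<union> K - {z}))" by (rule conn) (use other in auto)
    moreover have "{u, v} \<union> (C \<union> K - {z}) = V - {z}" using V d z by auto
    ultimately have c: "conn (V - {z})" by simp
    have Vz: "V - (V - {z}) = {z}" "z \<in> V" "z \<noteq> u" "u \<in> V" using V z d by auto
    show "z \<in> S"
    proof (cases "z \<in> C")
      case True
      then have "z \<notin> K" "z \<noteq> u" "z \<noteq> v" using d by auto
      then have "pclosed {z}" unfolding pclosed_def R' using Vz(2) by blast
      then have "bnd {z}" using c Vz by (auto simp: bnd_def)
      then show ?thesis using S(3) by fastforce
    next
      case False
      then have "(z, y) \<notin> R" for y using d z by (auto simp: R')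
      then have "pclosed (V - {z})" unfolding pclosed_def using R_in_V by blast
      then have "bnd (V - {z})" using c Vz by (auto simp: bnd_def)
      then have "par S (V - {z})" using S(3) by blast
      then show ?thesis using par_Diff[OF finite_V S(1,2), of "{z}"] Vz by simp
    qed
  qed
  have half: "odd (card C) \<noteq> (a \<in> S)" if ab: "{a, b} = {u, v}" for a b
  proof -
    have aC: "a \<notin> C" "a \<noteq> b" "a \<notin> K" "b \<notin> C" "b \<notin> K" "a \<in> V" "b \<in> V" using ab d V by (auto simp: doubleton_eq_iff)
    have Rab: "(x, y) \<in> R \<longleftrightarrow> x \<in> C \<and> y \<in> {a, b} \<or> x \<in> {a, b} \<and> y \<in> K" for x y using R' ab by simp
    have Veq: "V = {a, b} \<union> C \<union> K" using V ab by simp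
    have "conn (insert a C)" by (rule conn_star) (auto simp: adj_def Rab)
    moreover have "conn (insert b K)" by (rule conn_star) (auto simp: adj_def Rab)
    moreover have "V - insert a C = insert b K" using Veq aC d by auto
    moreover have "pclosed (insert a C)" unfolding pclosed_def Rab using Veq aC d(4) by auto
    ultimately have "bnd (insert a C)" using aC by (auto simp: bnd_def)
    then have "par S (insert a C)" using S(3) by blast
    then have "par S C \<noteq> (a \<in> S)" using par_insert[OF finS aC(1)] by simp
    moreover have "S \<inter> C = C" using sub by auto
    ultimately show ?thesis by (simp add: par_def)
  qed
  have uv: "u \<in> S \<longleftrightarrow> v \<in> S" using half[of u v] half[of v u] by auto
  have fin: "finite (C \<union> K)" using finite_V V by auto
  have "even (card (C \<union> K))"
  proof (cases "u \<in> S")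
    case True
    then have "S = insert u (insert v (C \<union> K))" using S(1) sub uv V by auto
    then have "card S = card (C \<union> K) + 2" using fin d by simp
    then show ?thesis using S(2) by simp
  next
    case False
    then have "S = C \<union> K" using S(1) sub uv V by auto
    then show ?thesis using S(2) by simp
  qed
  moreover have "card V = card (C \<union> K) + 2"
  proof -
    have "V = insert u (insert v (C \<union> K))" using V by auto
    then show ?thesis using fin d by simp
  qed
  ultimately show "even (card V)" by simp
qed

end

section \<open>Directed bonds as connected closed sets, and joins\<close>

context fin_digraph
begin

interpretation V: vertex_digraph "verts G" "arcs_ends G"
  by unfold_locales (auto simp: arcs_ends_conv)

lemma adj_iff: "V.adj x y \<longleftrightarrow> (\<exists>e\<in>arcs G. tail G e = x \<and> head G e = y \<or> tail G e = y \<and> head G e = x)"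
  unfolding V.adj_def unfolding arcs_ends_conv by auto

lemma boundary_nonempty:
  assumes "V.conn (verts G)" "X \<subseteq> verts G" "X \<noteq> {}" "X \<noteq> verts G"
  shows "boundary G X \<noteq> {}"
proof -
  obtain x y where "x \<in> X" "y \<in> verts G - X" "V.adj x y" using V.connD[OF assms] .
  then show ?thesis unfolding adj_iff boundary_def by blast
qed

lemma conn_uncut:
  assumes "V.conn X" "\<And>e. e \<in> arcs G \<Longrightarrow> tail G e \<in> X \<Longrightarrow> head G e \<in> X \<Longrightarrow> e \<notin> boundary G Z"
  shows "X \<inter> Z = {} \<or> X \<subseteq> Z"
proof (rule ccontr)
  assume n: "\<not> ?thesis"
  then have "X \<inter> Z \<subseteq> X" "X \<inter> Z \<noteq> {}" "X \<inter> Z \<noteq> X" by auto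
  then obtain x y where xy: "x \<in> X \<inter> Z" "y \<in> X - X \<inter> Z" "V.adj x y" using V.connD[OF assms(1)] by metis
  then obtain e where "e \<in> arcs G" "tail G e = x \<and> head G e = y \<or> tail G e = y \<and> head G e = x"
    unfolding adj_iff by blast
  then show False using assms(2)[of e] xy by (auto simp: boundary_def)
qed

lemma in_closed_iff_pclosed: "X \<subseteq> verts G \<Longrightarrow> in_closed G X \<longleftrightarrow> V.pclosed X"
  unfolding in_closed_def V.pclosed_def unfolding arcs_ends_conv by auto

text \<open>A cut inside that of \<open>X\<close> splits neither of the two connected sides, so if
  it is nonempty it is the same cut.\<close>

lemma directed_bond_if_bnd:
  assumes "V.conn (verts G)" "V.bnd X"
  shows "directed_bond G (boundary G X)"
proof -
  have X: "X \<subseteq> verts G" "X \<noteq> {}" "X \<noteq> verts G" "V.conn X" "V.conn (verts G - X)" "V.pclosed X"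
    using assms(2) V.pclosed_subset by (auto simp: V.bnd_def)
  have "bond G (boundary G X)"
  proof (rule bondI)
    show "boundary G X \<noteq> {}" using boundary_nonempty assms(1) X by blast
    fix Z assume Z: "boundary G Z \<noteq> {}" "boundary G Z \<subseteq> boundary G X"
    have "X \<inter> Z = {} \<or> X \<subseteq> Z"
      by (rule conn_uncut[OF X(4)]) (use Z in \<open>auto simp: boundary_def\<close>)
    moreover have "(verts G - X) \<inter> Z = {} \<or> verts G - X \<subseteq> Z"
      by (rule conn_uncut[OF X(5)]) (use Z in \<open>auto simp: boundary_def\<close>)
    moreover have "\<not> verts G \<subseteq> Z" "verts G \<inter> Z \<noteq> {}"
      using Z(1) wellformed unfolding boundary_def by blast+
    ultimately have "verts G \<inter> Z = X \<or> verts G \<inter> Z = verts G - X" using X(1) by blast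
    then show "boundary G X \<subseteq> boundary G Z"
      using wellformed unfolding boundary_def by blast
  qed simp
  moreover have "in_closed G X" using in_closed_iff_pclosed[OF X(1)] X(6) by simp
  ultimately show ?thesis unfolding directed_bond_iff by blast
qed

text \<open>If \<open>P\<close> had no arc to \<open>Y - P\<close>, the cut of \<open>Y\<close>
  would contain the disjoint cuts of \<open>P\<close> and \<open>Y - P\<close>. Both are nonempty
  because the digraph is connected, against minimality.\<close>

lemma bond_side_conn:
  assumes cV: "V.conn (verts G)" and b: "bond G (boundary G Y)" and Y: "Y \<subseteq> verts G"
  shows "V.conn Y"
  unfolding V.conn_def
proof (intro allI impI, rule ccontr)
  fix P assume P: "P \<subseteq> Y \<and> P \<noteq> {} \<and> P \<noteq> Y" and "\<not> (\<exists>x\<in>P. \<exists>y\<in>Y - P. V.adj x y)"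
  then have no: "\<not> V.adj x y" if "x \<in> P" "y \<in> Y - P" for x y using that by blast
  have e: "\<not> (tail G e \<in> P \<and> head G e \<in> Y - P)" "\<not> (head G e \<in> P \<and> tail G e \<in> Y - P)" if "e \<in> arcs G" for e
    using no that unfolding adj_iff by blast+
  have "Y \<noteq> verts G" using bondD(1)[OF b] wellformed by (auto simp: boundary_def)
  then have ne: "boundary G P \<noteq> {}" "boundary G (Y - P) \<noteq> {}"
    using boundary_nonempty[OF cV, of P] boundary_nonempty[OF cV, of "Y - P"] P Y by blast+
  have "boundary G P \<subseteq> boundary G Y" using e P unfolding boundary_def by blast
  then have "boundary G P = boundary G Y" using bondD(3)[OF b] ne by blast
  moreover have "boundary G (Y - P) \<subseteq> boundary G Y" "boundary G (Y - P) \<inter> boundary G P = {}"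
    using e P unfolding boundary_def by blast+
  ultimately show False using ne by blast
qed

lemma directed_bondE:
  assumes cV: "V.conn (verts G)" and S: "directed_bond G S"
  obtains X where "V.bnd X" "S = boundary G X"
proof -
  obtain X0 where X0: "bond G S" "S = boundary G X0" "in_closed G X0" using S directed_bond_iff by blast
  define X where "X = X0 \<inter> verts G"
  have SX: "S = boundary G X" using X0 boundary_Int_verts by (simp add: X_def)
  have XV: "X \<subseteq> verts G" by (simp add: X_def)
  have "in_closed G X" using X0(3) by (auto simp: in_closed_def X_def)
  then have cl: "V.pclosed X" using in_closed_iff_pclosed XV by blast
  have SX': "S = boundary G (verts G - X)" unfolding SX using wellformed by (auto simp: boundary_def)
  have "V.conn X" "V.conn (verts G - X)"
    using bond_side_conn[OF cV _ XV] bond_side_conn[OF cV, of "verts G - X"] X0(1) SX SX' by auto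
  moreover have "X \<noteq> {}" "X \<noteq> verts G"
    using bondD(1)[OF X0(1)] SX wellformed by (auto simp: boundary_def)
  ultimately show thesis using that cl SX by (auto simp: V.bnd_def)
qed

text \<open>The vertices of odd degree in \<open>J\<close>, loops not counted: the set
  \<open>T\<close> for which \<open>J\<close> is a \<open>T\<close>-join.\<close>

definition odd_verts :: "'b set \<Rightarrow> 'a set" where
  "odd_verts J = {v \<in> verts G. par J (boundary G {v})}"

text \<open>Modulo 2 the cut of \<open>X\<close> is the sum of the cuts of its single
  vertices.\<close>

lemma par_odd_verts:
  assumes J: "J \<subseteq> arcs G" and X: "X \<subseteq> verts G"
  shows "par (odd_verts J) X \<longleftrightarrow> par J (boundary G X)"
proof -
  have finJ: "finite J" and finS: "finite (odd_verts J)"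
    using J finite_subset[OF _ finite_arcs] by (auto simp: odd_verts_def)
  have "finite X" using X finite_subset[OF _ finite_verts] by blast
  then show ?thesis using X
  proof (induction X rule: finite_induct)
    case empty
    then show ?case by (simp add: boundary_def)
  next
    case (insert a X)
    have "boundary G (insert a X) = sym_diff (boundary G {a}) (boundary G X)"
      using insert.hyps(2) by (auto simp: boundary_def)
    then show ?case
      using insert par_insert[OF finS insert.hyps(2)] par_sym_diff_right[OF finJ, of "boundary G {a}" "boundary G X"]
      by (auto simp: odd_verts_def)
  qed
qed

lemma even_card_odd_verts:
  assumes J: "J \<subseteq> arcs G" shows "even (card (odd_verts J))"
proof -
  have "boundary G (verts G) = {}" by (auto simp: boundary_def)
  then have "\<not> par (odd_verts J) (verts G)" using par_odd_verts[OF J, of "verts G"] by simp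
  moreover have "odd_verts J \<inter> verts G = odd_verts J" by (auto simp: odd_verts_def)
  ultimately show ?thesis by (simp add: par_def)
qed

text \<open>\<open>J\<close> plays the role of an undirected path from \<open>a\<close> to
  \<open>b\<close>, described only by the cuts that it meets oddly. The set of ends reachable in
  this sense cannot be a proper part of a connected digraph.\<close>

lemma ex_path_join:
  assumes cV: "V.conn (verts G)" and a: "a \<in> verts G" and b: "b \<in> verts G"
  shows "\<exists>J\<subseteq>arcs G. \<forall>X. par J (boundary G X) \<longleftrightarrow> (a \<in> X) \<noteq> (b \<in> X)"
proof -
  define Q where "Q = {b \<in> verts G. \<exists>J\<subseteq>arcs G. \<forall>X. par J (boundary G X) \<longleftrightarrow> (a \<in> X) \<noteq> (b \<in> X)}"
  have "a \<in> Q" unfolding Q_def using a by (auto simp: par_def intro!: exI[of _ "{}"])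
  have "Q = verts G"
  proof (rule ccontr)
    assume "Q \<noteq> verts G"
    moreover have "Q \<subseteq> verts G" "Q \<noteq> {}" using \<open>a \<in> Q\<close> by (auto simp: Q_def)
    ultimately obtain x y where xy: "x \<in> Q" "y \<in> verts G - Q" "V.adj x y" using V.connD[OF cV] by metis
    then obtain J where J: "J \<subseteq> arcs G" "\<And>X. par J (boundary G X) \<longleftrightarrow> (a \<in> X) \<noteq> (x \<in> X)"
      by (auto simp: Q_def)
    obtain e where e: "e \<in> arcs G" "tail G e = x \<and> head G e = y \<or> tail G e = y \<and> head G e = x"
      using xy(3) unfolding adj_iff by blast
    have finJ: "finite J" using J(1) finite_subset[OF _ finite_arcs] by blast
    have pe: "par {e} (boundary G X) \<longleftrightarrow> (x \<in> X) \<noteq> (y \<in> X)" for X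
    proof -
      have "par {e} (boundary G X) \<longleftrightarrow> e \<in> boundary G X" by simp
      then show ?thesis using e by (auto simp: boundary_def)
    qed
    have "par (sym_diff J {e}) (boundary G X) \<longleftrightarrow> (a \<in> X) \<noteq> (y \<in> X)" for X
      using par_sym_diff_left[OF finJ, of "{e}" "boundary G X"] J(2)[of X] pe[of X] by auto
    moreover have "sym_diff J {e} \<subseteq> arcs G" using J(1) e(1) by auto
    ultimately have "y \<in> Q" using xy(2) unfolding Q_def by blast
    then show False using xy(2) by blast
  qed
  then show ?thesis using b by (auto simp: Q_def)
qed

lemma ex_join:
  assumes cV: "V.conn (verts G)" and S: "S \<subseteq> verts G" "even (card S)"
  shows "\<exists>J\<subseteq>arcs G. \<forall>X\<subseteq>verts G. par J (boundary G X) \<longleftrightarrow> par S X"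
proof (cases "S = {}")
  case True
  then show ?thesis by (intro exI[of _ "{}"]) (auto simp: par_def)
next
  case False
  then obtain r where r: "r \<in> verts G" using S by blast
  have fin: "finite S" using S(1) finite_subset[OF _ finite_verts] by blast
  \<comment> \<open>\<open>J\<close> is the sum of paths from the vertices of \<open>S\<close> to a
    root \<open>r\<close>. The correction at \<open>r\<close> accounts for an odd number of paths
    and disappears for the even set required.\<close>
  have "\<exists>J\<subseteq>arcs G. \<forall>X. par J (boundary G X) \<longleftrightarrow> par S X \<noteq> (r \<in> X \<and> odd (card S))"
    using fin S(1)
  proof (induction S rule: finite_induct)
    case empty
    then show ?case by (intro exI[of _ "{}"]) (auto simp: par_def)
  next
    case (insert a S)
    then obtain J where J: "J \<subseteq> arcs G" "\<And>X. par J (boundary G X) \<longleftrightarrow> par S X \<noteq> (r \<in> X \<and> odd (card S))"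
      by auto
    obtain J' where J': "J' \<subseteq> arcs G" "\<And>X. par J' (boundary G X) \<longleftrightarrow> (a \<in> X) \<noteq> (r \<in> X)"
      using ex_path_join[OF cV _ r, of a] insert.prems by auto
    have f: "finite J" "finite J'" using J(1) J'(1) finite_subset[OF _ finite_arcs] by blast+
    have ins: "par (insert a S) X \<longleftrightarrow> par S X \<noteq> (a \<in> X)" for X
      using insert.hyps by (cases "a \<in> X") (auto simp: par_def)
    have "par (sym_diff J J') (boundary G X) \<longleftrightarrow> par (insert a S) X \<noteq> (r \<in> X \<and> odd (card (insert a S)))" for X
      unfolding par_sym_diff_left[OF f] J(2) J'(2) ins using insert.hyps by auto
    moreover have "sym_diff J J' \<subseteq> arcs G" using J(1) J'(1) by auto
    ultimately show ?case by blast
  qed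
  then show ?thesis using S(2) by auto
qed

lemma odd_dijoin_odd_verts:
  assumes cV: "V.conn (verts G)" and J: "odd_dijoin G J"
  shows "odd_verts J \<subseteq> verts G" "even (card (odd_verts J))" "\<And>X. V.bnd X \<Longrightarrow> par (odd_verts J) X"
proof -
  have JA: "J \<subseteq> arcs G" using J by (simp add: odd_dijoin_def)
  show "odd_verts J \<subseteq> verts G" by (auto simp: odd_verts_def)
  show "even (card (odd_verts J))" using even_card_odd_verts[OF JA] .
  fix X assume X: "V.bnd X"
  then have "par J (boundary G X)" using J directed_bond_if_bnd[OF cV X] by (simp add: odd_dijoin_iff)
  then show "par (odd_verts J) X"
    using par_odd_verts[OF JA] X V.pclosed_subset by (simp add: V.bnd_def)
qed

lemma no_odd_dijoin_diamond:
  assumes "diamond G" "odd (card (verts G))" shows "\<not> odd_dijoin G J"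
proof
  assume J: "odd_dijoin G J"
  obtain u v X where D: "u \<noteq> v \<and> u \<notin> X \<and> v \<notin> X \<and> finite X \<and> card X \<ge> 3 \<and> verts G = {u, v} \<union> X \<and>
     (\<forall>x \<in> X.
        (\<exists>e1 e2. out_arcs G x = {e1, e2} \<and> head G e1 = u \<and> head G e2 = v \<and> in_arcs G x = {}) \<or>
        (\<exists>e1 e2. in_arcs G x = {e1, e2} \<and> tail G e1 = u \<and> tail G e2 = v \<and> out_arcs G x = {})) \<and>
     (\<forall>e \<in> arcs G. tail G e \<in> X \<or> head G e \<in> X)"
    using assms(1) unfolding diamond_def by (elim exE)
  then have d: "u \<noteq> v" "u \<notin> X" "v \<notin> X" "finite X" "card X \<ge> 3" "verts G = {u, v} \<union> X"
    and xs: "\<And>x. x \<in> X \<Longrightarrow>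
        (\<exists>e1 e2. out_arcs G x = {e1, e2} \<and> head G e1 = u \<and> head G e2 = v \<and> in_arcs G x = {}) \<or>
        (\<exists>e1 e2. in_arcs G x = {e1, e2} \<and> tail G e1 = u \<and> tail G e2 = v \<and> out_arcs G x = {})"
    and inc: "\<And>e. e \<in> arcs G \<Longrightarrow> tail G e \<in> X \<or> head G e \<in> X"
    by simp_all
  define C where "C = {x \<in> X. in_arcs G x = {}}"
  define K where "K = X - C"
  have Cx: "(\<exists>e\<in>arcs G. tail G e = x \<and> head G e = y) \<longleftrightarrow> y \<in> {u, v}" if "x \<in> C" for x y
  proof -
    have "x \<in> X" "in_arcs G x = {}" using that unfolding C_def by blast+
    then obtain e1 e2 where "out_arcs G x = {e1, e2}" "head G e1 = u" "head G e2 = v"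
      using xs[of x] by (metis insert_not_empty)
    moreover from this have "e \<in> arcs G \<and> tail G e = x \<longleftrightarrow> e = e1 \<or> e = e2" for e
      by (metis empty_iff in_out_arcs_conv insert_iff)
    ultimately show ?thesis by (metis empty_iff insert_iff)
  qed
  have Kx: "(\<exists>e\<in>arcs G. tail G e = y \<and> head G e = x) \<longleftrightarrow> y \<in> {u, v}" "out_arcs G x = {}" if xK: "x \<in> K" for x y
  proof -
    obtain e1 e2 where *: "in_arcs G x = {e1, e2}" "tail G e1 = u" "tail G e2 = v" "out_arcs G x = {}"
      using xs[of x] xK unfolding C_def K_def by blast
    from *(1) have "e \<in> arcs G \<and> head G e = x \<longleftrightarrow> e = e1 \<or> e = e2" for e
      by (metis empty_iff in_in_arcs_conv insert_iff)
    with *(2,3) show "(\<exists>e\<in>arcs G. tail G e = y \<and> head G e = x) \<longleftrightarrow> y \<in> {u, v}"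
      by (metis empty_iff insert_iff)
    show "out_arcs G x = {}" using * by blast
  qed
  have CK: "X = C \<union> K" "C \<inter> K = {}" by (auto simp: C_def K_def)
  have R: "arcs_ends G = C \<times> {u, v} \<union> {u, v} \<times> K"
  proof (intro equalityI subsetI)
    fix p assume "p \<in> arcs_ends G"
    then obtain e where e: "e \<in> arcs G" "p = (tail G e, head G e)" by (auto simp: arcs_ends_conv)
    have "e \<in> out_arcs G (tail G e)" "e \<in> in_arcs G (head G e)" using e(1) by simp_all
    then have "tail G e \<notin> K" "head G e \<notin> C" using Kx(2)[of "tail G e"] unfolding C_def by blast+
    then have "tail G e \<in> C \<or> head G e \<in> K" using inc[OF e(1)] CK(1) by blast
    then show "p \<in> C \<times> {u, v} \<union> {u, v} \<times> K"
    proof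
      assume "tail G e \<in> C"
      moreover from this have "head G e \<in> {u, v}" using Cx[of "tail G e" "head G e"] e(1) by blast
      ultimately show ?thesis using e(2) by simp
    next
      assume "head G e \<in> K"
      moreover from this have "tail G e \<in> {u, v}" using Kx(1)[of "head G e" "tail G e"] e(1) by blast
      ultimately show ?thesis using e(2) by simp
    qed
  next
    fix p assume "p \<in> C \<times> {u, v} \<union> {u, v} \<times> K"
    then have "\<exists>e\<in>arcs G. tail G e = fst p \<and> head G e = snd p"
      using Cx[of "fst p" "snd p"] Kx(1)[of "snd p" "fst p"] by (metis UnE mem_Times_iff)
    then show "p \<in> arcs_ends G" unfolding arcs_ends_conv by force
  qed
  have Veq: "verts G = {u, v} \<union> C \<union> K" using d CK by auto
  have n: "u \<notin> C \<union> K" "v \<notin> C \<union> K" "2 \<le> card (C \<union> K)" using d CK by auto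
  note D = V.diamond_even[OF R Veq d(1) n(1,2) CK(2) n(3)]
  have cV: "V.conn (verts G)" by (rule V.diamond_conn[OF R Veq n(3)])
  have "even (card (verts G))"
    by (rule D[OF odd_dijoin_odd_verts[OF cV J]])
  with assms(2) show False by simp
qed

lemma no_odd_dijoin_one_direction:
  assumes "one_direction G" "odd (card (verts G))" shows "\<not> odd_dijoin G J"
proof
  assume J: "odd_dijoin G J"
  obtain n1 n2 where n: "n1 \<ge> 2" "n2 \<ge> 2" and iso: "digraph_iso G (one_way_bipartite n1 n2)"
    using assms(1) unfolding one_direction_def by (elim exE conjE)
  obtain f where f: "digraph_isomorphism f" and eq: "one_way_bipartite n1 n2 = app_iso f G"
    using iso unfolding digraph_iso_def by (elim exE conjE)
  let ?f = "iso_verts f"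
  have inj: "inj_on ?f (verts G)" using f by (rule digraph_isomorphism_inj_on_verts)
  have verts: "?f ` verts G = {..<n1} <+> {..<n2}"
    using arg_cong[OF eq, of verts] by (simp add: one_way_bipartite_def)
  have arcs: "iso_arcs f ` arcs G = {..<n1} \<times> {..<n2}"
    using arg_cong[OF eq, of arcs] by (simp add: one_way_bipartite_def)
  have tl: "iso_tail f p = Inl (fst p)" and hd: "iso_head f p = Inr (snd p)" for p
    using arg_cong[OF eq, of "\<lambda>G. tail G p"] arg_cong[OF eq, of "\<lambda>G. head G p"]
    by (simp_all add: one_way_bipartite_def)
  define C where "C = {x \<in> verts G. ?f x \<in> Inl ` {..<n1}}"
  have CV: "C \<subseteq> verts G" by (auto simp: C_def)
  have fC: "?f ` C = Inl ` {..<n1}"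
  proof -
    have "?f ` C = ?f ` verts G \<inter> Inl ` {..<n1}" by (auto simp: C_def)
    then show ?thesis unfolding verts by auto
  qed
  have fK: "?f ` (verts G - C) = Inr ` {..<n2}"
  proof -
    have "?f ` (verts G - C) = ?f ` verts G - Inl ` {..<n1}" by (auto simp: C_def)
    then show ?thesis unfolding verts by auto
  qed
  have "card C = n1"
    using card_image[OF inj_on_subset[OF inj CV]] fC by (simp add: card_image)
  moreover have "card (verts G - C) = n2"
    using card_image[OF inj_on_subset[OF inj, of "verts G - C"]] fK by (simp add: card_image)
  ultimately have cards: "2 \<le> card C" "2 \<le> card (verts G - C)" using n by auto
  have R: "arcs_ends G = C \<times> (verts G - C)"
  proof (intro equalityI subsetI)
    fix p assume "p \<in> arcs_ends G"
    then obtain e where e: "e \<in> arcs G" "p = (tail G e, head G e)" by (auto simp: arcs_ends_conv)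
    have ie: "iso_arcs f e \<in> {..<n1} \<times> {..<n2}" using arcs e by blast
    have "?f (tail G e) = Inl (fst (iso_arcs f e))" "?f (head G e) = Inr (snd (iso_arcs f e))"
      using iso_verts_tail[OF f e(1)] iso_verts_head[OF f e(1)] tl hd by auto
    then show "p \<in> C \<times> (verts G - C)" using e ie by (auto simp: C_def)
  next
    fix p assume p: "p \<in> C \<times> (verts G - C)"
    obtain i where i: "i < n1" "?f (fst p) = Inl i" using p fC by (metis imageE imageI lessThan_iff mem_Times_iff)
    obtain j where j: "j < n2" "?f (snd p) = Inr j" using p fK by (metis imageE imageI lessThan_iff mem_Times_iff)
    obtain e where e: "e \<in> arcs G" "iso_arcs f e = (i, j)" using arcs i j by (metis (no_types) SigmaI imageE lessThan_iff)
    have "?f (tail G e) = ?f (fst p)" "?f (head G e) = ?f (snd p)"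
      using iso_verts_tail[OF f e(1)] iso_verts_head[OF f e(1)] tl hd e i j by auto
    then have "tail G e = fst p" "head G e = snd p"
      using inj_onD[OF inj] e(1) p CV by (auto simp: mem_Times_iff)
    then show "p \<in> arcs_ends G" unfolding arcs_ends_conv using e(1) by force
  qed
  have cV: "V.conn (verts G)" by (rule V.complete_bipartite_conn[OF R CV cards])
  have "even (card (verts G))"
    by (rule V.complete_bipartite_even[OF R CV cards odd_dijoin_odd_verts[OF cV J]])
  with assms(2) show False by simp
qed

end

section \<open>Minimal digraphs without an odd dijoin\<close>

text \<open>The field \<open>contract_join\<close> restates in terms of \<open>G\<close> alone that
  contracting \<open>e\<close> yields an odd dijoin, since the directed bonds of the contraction are
  those of \<open>G\<close> avoiding \<open>e\<close>.\<close>

locale minimal_no_odd_dijoin = fin_digraph +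
  assumes no_odd_dijoin: "\<And>J. \<not> odd_dijoin G J"
    and contract_join: "\<And>e. e \<in> arcs G \<Longrightarrow> \<exists>J\<subseteq>arcs G. \<forall>S. directed_bond G S \<longrightarrow> e \<notin> S \<longrightarrow> par J S"
    and no_deletable: "\<And>e. \<not> deletable G e"
    and no_isolated: "\<And>v. \<not> isolated G v"
begin

interpretation V: vertex_digraph "verts G" "arcs_ends G"
  by unfold_locales (auto simp: arcs_ends_conv)

text \<open>A loop lies in no cut, so the set that \<open>contract_join\<close> gives for it would
  already be an odd dijoin.\<close>

lemma ends_distinct:
  assumes e: "e \<in> arcs G" shows "tail G e \<noteq> head G e"
proof
  assume eq: "tail G e = head G e"
  obtain J where J: "J \<subseteq> arcs G" "\<And>S. directed_bond G S \<Longrightarrow> e \<notin> S \<Longrightarrow> par J S"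
    using contract_join[OF e] by blast
  have "par J S" if "directed_bond G S" for S
  proof -
    obtain X where "S = boundary G X" using \<open>directed_bond G S\<close> directed_bond_iff by blast
    then have "e \<notin> S" using eq by (simp add: boundary_def)
    then show ?thesis using J(2)[OF that] by simp
  qed
  then have "odd_dijoin G J" using J(1) by (simp add: odd_dijoin_iff)
  then show False using no_odd_dijoin by blast
qed

lemma no_parallel:
  assumes "e \<in> arcs G" "f \<in> arcs G" "tail G e = tail G f" "head G e = head G f"
  shows "e = f"
proof (rule ccontr)
  assume "e \<noteq> f"
  have "apath (tail G e) [f] (head G e)"
    using assms ends_distinct[of f] by (auto simp: apath_def awalk_def)
  then have "deletable G e" unfolding deletable_def using assms ends_distinct[of e] \<open>e \<noteq> f\<close>
    by (intro conjI exI[of _ "[f]"]) auto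
  then show False using no_deletable by blast
qed

lemma no_transitive:
  assumes "(x, y) \<in> arcs_ends G" "(y, z) \<in> arcs_ends G"
  shows "(x, z) \<notin> arcs_ends G"
proof
  assume "(x, z) \<in> arcs_ends G"
  with assms obtain e f g where
    e: "e \<in> arcs G" "tail G e = x" "head G e = y" and
    f: "f \<in> arcs G" "tail G f = y" "head G f = z" and
    g: "g \<in> arcs G" "tail G g = x" "head G g = z"
    by (metis reachableE)
  have n: "x \<noteq> y" "y \<noteq> z" "x \<noteq> z" using ends_distinct[OF e(1)] ends_distinct[OF f(1)] ends_distinct[OF g(1)] e f g by auto
  have "apath (tail G g) [e, f] (head G g)" using e f g n by (auto simp: apath_def awalk_def)
  moreover have "g \<notin> set [e, f]" using e f g n by auto
  ultimately have "deletable G g" unfolding deletable_def using g n by blast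
  then show False using no_deletable by blast
qed

text \<open>A bond cannot meet both parts of a disconnected digraph. Both parts contain arcs, as no
  vertex is isolated; on each part one uses the join belonging to an arc of the other part, and the
  glued set is an odd dijoin.\<close>

lemma weakly_conn: "V.conn (verts G)"
proof (rule ccontr)
  assume "\<not> V.conn (verts G)"
  then obtain P where P: "P \<subseteq> verts G" "P \<noteq> {}" "P \<noteq> verts G"
    and no: "\<And>x y. x \<in> P \<Longrightarrow> y \<in> verts G - P \<Longrightarrow> \<not> V.adj x y"
    unfolding V.conn_def by blast
  define A where "A = {e \<in> arcs G. tail G e \<in> P}"
  have A: "head G e \<in> P \<longleftrightarrow> tail G e \<in> P" if "e \<in> arcs G" for e
    using no[of "tail G e" "head G e"] no[of "head G e" "tail G e"] that wellformed[OF that]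
    unfolding adj_iff by blast
  have inc: "\<exists>e\<in>arcs G. tail G e = v \<or> head G e = v" if v: "v \<in> verts G" for v
    using no_isolated[of v] v unfolding isolated_def in_arcs_def out_arcs_def by blast
  obtain p where "p \<in> P" using P by blast
  then obtain e where e: "e \<in> arcs G" "e \<in> A" using inc[of p] P(1) A unfolding A_def by blast
  obtain q where "q \<in> verts G - P" using P by blast
  then obtain f where f: "f \<in> arcs G" "f \<notin> A" using inc[of q] A unfolding A_def by blast
  obtain Je where Je: "Je \<subseteq> arcs G" "\<And>S. directed_bond G S \<Longrightarrow> e \<notin> S \<Longrightarrow> par Je S"
    using contract_join[OF e(1)] by blast
  obtain Jf where Jf: "Jf \<subseteq> arcs G" "\<And>S. directed_bond G S \<Longrightarrow> f \<notin> S \<Longrightarrow> par Jf S"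
    using contract_join[OF f(1)] by blast
  define J where "J = (Jf \<inter> A) \<union> (Je - A)"
  have "par J S" if S: "directed_bond G S" for S
  proof -
    obtain X where b: "bond G S" and X: "S = boundary G X" using S directed_bond_iff by blast
    have i: "boundary G (X \<inter> P) = S \<inter> A" and o: "boundary G (X - P) = S - A"
      unfolding X boundary_def A_def using A by blast+
    have "S \<inter> A = {} \<or> S \<inter> A = S"
      using bondD(3)[OF b, of "X \<inter> P"] unfolding i by blast
    then show ?thesis
    proof
      assume *: "S \<inter> A = {}"
      then have "J \<inter> S = Je \<inter> S" "e \<notin> S" using e by (auto simp: J_def)
      then show ?thesis using Je(2)[OF S] by (simp add: par_def)
    next
      assume *: "S \<inter> A = S"
      then have "J \<inter> S = Jf \<inter> S" "f \<notin> S" using f by (auto simp: J_def)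
      then show ?thesis using Jf(2)[OF S] by (simp add: par_def)
    qed
  qed
  moreover have "J \<subseteq> arcs G" using Je(1) Jf(1) by (auto simp: J_def)
  ultimately show False using no_odd_dijoin by (auto simp: odd_dijoin_iff)
qed

lemma ex_vertex_set:
  assumes "p \<in> arcs_ends G"
  shows "\<exists>S\<subseteq>verts G. even (card S) \<and> (\<forall>X. V.bnd X \<longrightarrow> V.uncut p X \<longrightarrow> par S X)"
proof -
  obtain e where e: "e \<in> arcs G" "p = (tail G e, head G e)" using assms by (auto simp: arcs_ends_conv)
  obtain J where J: "J \<subseteq> arcs G" "\<And>S. directed_bond G S \<Longrightarrow> e \<notin> S \<Longrightarrow> par J S"
    using contract_join[OF e(1)] by blast
  have "par (odd_verts J) X" if X: "V.bnd X" "V.uncut p X" for X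
  proof -
    have "e \<notin> boundary G X" using X(2) e(2) by (auto simp: V.uncut_def boundary_def)
    then have "par J (boundary G X)" using J(2) directed_bond_if_bnd[OF weakly_conn X(1)] by blast
    moreover have "X \<subseteq> verts G" using X(1) V.pclosed_subset by (simp add: V.bnd_def)
    ultimately show ?thesis using par_odd_verts[OF J(1)] by simp
  qed
  moreover have "odd_verts J \<subseteq> verts G" by (auto simp: odd_verts_def)
  ultimately show ?thesis using even_card_odd_verts[OF J(1)] by blast
qed

lemma no_vertex_set:
  assumes S: "S \<subseteq> verts G" "even (card S)"
  shows "\<exists>X. V.bnd X \<and> \<not> par S X"
proof (rule ccontr)
  assume all: "\<not> ?thesis"
  obtain J where J: "J \<subseteq> arcs G" "\<And>X. X \<subseteq> verts G \<Longrightarrow> par J (boundary G X) \<longleftrightarrow> par S X"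
    using ex_join[OF weakly_conn S] by blast
  have "par J B" if B: "directed_bond G B" for B
  proof -
    obtain X where X: "V.bnd X" "B = boundary G X" using directed_bondE[OF weakly_conn B] .
    then have "X \<subseteq> verts G" using V.pclosed_subset by (simp add: V.bnd_def)
    then show ?thesis using J(2) all X by blast
  qed
  then show False using J(1) no_odd_dijoin by (auto simp: odd_dijoin_iff)
qed

text \<open>The arc relation determines the digraph up to isomorphism because
  \<open>no_parallel\<close> makes the map from arcs to pairs of end indices injective.\<close>

lemma one_directionI:
  assumes C: "C \<subseteq> verts G" and R: "arcs_ends G = C \<times> (verts G - C)"
    and n: "2 \<le> card C" "2 \<le> card (verts G - C)"
  shows "one_direction G"
proof -
  define n1 n2 where "n1 = card C" and "n2 = card (verts G - C)"
  have "finite C" "finite (verts G - C)" using C finite_subset[OF _ finite_verts] by auto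
  then obtain g h where g: "bij_betw g C {..<n1}" and h: "bij_betw h (verts G - C) {..<n2}"
    using ex_bij_betw_finite_nat unfolding n1_def n2_def atLeast0LessThan by metis
  define \<phi> where "\<phi> v = (if v \<in> C then Inl (g v) else Inr (h v))" for v
  define F where "F = \<lparr> iso_verts = \<phi>, iso_arcs = (\<lambda>e. (g (tail G e), h (head G e))),
    iso_head = (\<lambda>p. Inr (snd p)), iso_tail = (\<lambda>p. Inl (fst p)) \<rparr>"
  have ends: "tail G e \<in> C" "head G e \<in> verts G - C" if "e \<in> arcs G" for e
    using that R unfolding arcs_ends_conv by auto
  have gi: "inj_on g C" "g ` C = {..<n1}" and hi: "inj_on h (verts G - C)" "h ` (verts G - C) = {..<n2}"
    using g h by (auto simp: bij_betw_def)
  have "digraph_isomorphism F"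
    unfolding digraph_isomorphism_def
  proof (intro conjI ballI)
    show "wf_digraph G" by (rule wf_digraph)
    show "inj_on (iso_verts F) (verts G)"
      using inj_onD[OF gi(1)] inj_onD[OF hi(1)]
      by (auto simp: F_def \<phi>_def inj_on_def split: if_splits)
    show "inj_on (iso_arcs F) (arcs G)"
    proof (rule inj_onI)
      fix e f assume "e \<in> arcs G" "f \<in> arcs G" "iso_arcs F e = iso_arcs F f"
      then show "e = f"
        using inj_onD[OF gi(1)] inj_onD[OF hi(1)] ends by (intro no_parallel) (auto simp: F_def)
    qed
    fix e assume "e \<in> arcs G"
    then show "iso_verts F (tail G e) = iso_tail F (iso_arcs F e)"
      "iso_verts F (head G e) = iso_head F (iso_arcs F e)"
      using ends[of e] by (auto simp: F_def \<phi>_def)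
  qed
  moreover have "one_way_bipartite n1 n2 = app_iso F G"
  proof -
    have "\<phi> ` verts G = \<phi> ` C \<union> \<phi> ` (verts G - C)" using C by auto
    also have "\<phi> ` C = Inl ` g ` C" by (auto simp: \<phi>_def image_image)
    also have "\<phi> ` (verts G - C) = Inr ` h ` (verts G - C)" by (auto simp: \<phi>_def image_image)
    finally have v: "\<phi> ` verts G = {..<n1} <+> {..<n2}" using gi(2) hi(2) by (simp add: Plus_def)
    have "(\<lambda>e. (g (tail G e), h (head G e))) ` arcs G = map_prod g h ` arcs_ends G"
      unfolding arcs_ends_conv by (auto simp: image_image)
    also have "\<dots> = g ` C \<times> h ` (verts G - C)" unfolding R by (rule map_prod_surj_on[OF HOL.refl HOL.refl])
    finally have a: "(\<lambda>e. (g (tail G e), h (head G e))) ` arcs G = {..<n1} \<times> {..<n2}"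
      using gi(2) hi(2) by simp
    show ?thesis using v a by (simp add: one_way_bipartite_def app_iso_def F_def)
  qed
  ultimately have "digraph_iso G (one_way_bipartite n1 n2)" unfolding digraph_iso_def by blast
  then show ?thesis unfolding one_direction_def using n n1_def n2_def by blast
qed

lemma diamondI:
  assumes d: "u \<noteq> v" "u \<notin> C \<union> K" "v \<notin> C \<union> K" "C \<inter> K = {}" "verts G = {u, v} \<union> C \<union> K"
    and R: "arcs_ends G = C \<times> {u, v} \<union> {u, v} \<times> K" and n: "3 \<le> card (C \<union> K)"
  shows "diamond G"
proof -
  have R': "(\<exists>e\<in>arcs G. tail G e = x \<and> head G e = y) \<longleftrightarrow> x \<in> C \<and> y \<in> {u, v} \<or> x \<in> {u, v} \<and> y \<in> K" for x y
  proof -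
    have "(\<exists>e\<in>arcs G. tail G e = x \<and> head G e = y) \<longleftrightarrow> (x, y) \<in> arcs_ends G"
      by (auto simp: arcs_ends_conv)
    then show ?thesis unfolding R by simp
  qed
  have ends: "tail G e \<in> C \<and> head G e \<in> {u, v} \<or> tail G e \<in> {u, v} \<and> head G e \<in> K" if "e \<in> arcs G" for e
    using R'[of "tail G e" "head G e"] that by blast
  have out: "\<exists>e1 e2. out_arcs G x = {e1, e2} \<and> head G e1 = u \<and> head G e2 = v \<and> in_arcs G x = {}"
    if x: "x \<in> C" for x
  proof -
    obtain e1 e2 where e: "e1 \<in> arcs G" "tail G e1 = x" "head G e1 = u" "e2 \<in> arcs G" "tail G e2 = x" "head G e2 = v"
      using R'[of x u] R'[of x v] x by blast
    have xn: "x \<noteq> u" "x \<noteq> v" "x \<notin> K" using x d by auto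
    have "f = e1 \<or> f = e2" if f: "f \<in> arcs G" "tail G f = x" for f
      using ends[OF f(1)] xn no_parallel[OF f(1) e(1)] no_parallel[OF f(1) e(4)] f e by auto
    then have "out_arcs G x = {e1, e2}" using e unfolding out_arcs_def by blast
    moreover have "in_arcs G x = {}" using ends xn x unfolding in_arcs_def by blast
    ultimately show ?thesis using e by blast
  qed
  have inn: "\<exists>e1 e2. in_arcs G x = {e1, e2} \<and> tail G e1 = u \<and> tail G e2 = v \<and> out_arcs G x = {}"
    if x: "x \<in> K" for x
  proof -
    obtain e1 e2 where e: "e1 \<in> arcs G" "tail G e1 = u" "head G e1 = x" "e2 \<in> arcs G" "tail G e2 = v" "head G e2 = x"
      using R'[of u x] R'[of v x] x by blast
    have xn: "x \<noteq> u" "x \<noteq> v" "x \<notin> C" using x d by auto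
    have "f = e1 \<or> f = e2" if f: "f \<in> arcs G" "head G f = x" for f
      using ends[OF f(1)] xn no_parallel[OF f(1) e(1)] no_parallel[OF f(1) e(4)] f e by auto
    then have "in_arcs G x = {e1, e2}" using e unfolding in_arcs_def by blast
    moreover have "out_arcs G x = {}" using ends xn x unfolding out_arcs_def by blast
    ultimately show ?thesis using e by blast
  qed
  have fin: "finite (C \<union> K)" using d(5) finite_verts by (metis finite_Un)
  show ?thesis
    unfolding diamond_def
    by (rule exI[of _ u], rule exI[of _ v], rule exI[of _ "C \<union> K"])
      (use d n fin out inn ends in \<open>simp add: Un_assoc ball_Un; blast\<close>)
qed

lemma odd_diamond_or_one_direction: "odd_diamond G \<or> odd_one_direction G"
proof -
  obtain T where T: "\<And>p. p \<in> arcs_ends G \<Longrightarrow>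
      T p \<subseteq> verts G \<and> even (card (T p)) \<and> (\<forall>X. V.bnd X \<longrightarrow> V.uncut p X \<longrightarrow> par (T p) X)"
    using ex_vertex_set by metis
  interpret E: critical_vertex_digraph "verts G" "arcs_ends G" T
    by unfold_locales (use T weakly_conn no_vertex_set no_transitive in blast)+
  show ?thesis
  proof (cases rule: E.complete_bipartite_or_diamond)
    case (one_way C)
    then show ?thesis using one_directionI[of C] by (simp add: odd_one_direction_def)
  next
    case (diamond u v C K)
    have "finite (C \<union> K)" using diamond(5) finite_verts by (metis finite_Un)
    moreover have "verts G = insert u (insert v (C \<union> K))" using diamond(5) by auto
    ultimately have "card (verts G) = card (C \<union> K) + 2" using diamond(1-3) by simp
    then show ?thesis using diamondI[of u v C K] diamond by (simp add: odd_diamond_def)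
  qed
qed

end

theorem theorem4p17:
  fixes D :: "('a, 'b) pre_digraph"
  assumes "fin_digraph D"
  shows "(\<exists>J. odd_dijoin D J) \<longleftrightarrow>
    \<not> (\<exists>H. cut_minor D H \<and> odd_diamond H) \<and>
    \<not> (\<exists>H. cut_minor D H \<and> odd_one_direction H)"
proof
  assume "\<exists>J. odd_dijoin D J"
  then obtain J where J: "odd_dijoin D J" by blast
  have "\<not> odd_diamond H \<and> \<not> odd_one_direction H" if H: "cut_minor D H" for H
  proof -
    obtain J' where J': "odd_dijoin H J'" using cut_minor_odd_dijoin[OF H assms J] by blast
    have "fin_digraph H" using cut_minor_fin_digraph[OF H assms] .
    then show ?thesis
      using J' fin_digraph.no_odd_dijoin_diamond fin_digraph.no_odd_dijoin_one_direction
      unfolding odd_diamond_def odd_one_direction_def by blast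
  qed
  then show "\<not> (\<exists>H. cut_minor D H \<and> odd_diamond H) \<and> \<not> (\<exists>H. cut_minor D H \<and> odd_one_direction H)"
    by blast
next
  assume no: "\<not> (\<exists>H. cut_minor D H \<and> odd_diamond H) \<and> \<not> (\<exists>H. cut_minor D H \<and> odd_one_direction H)"
  show "\<exists>J. odd_dijoin D J"
  proof (rule ccontr)
    assume none: "\<not> ?thesis"
    define P where "P H \<longleftrightarrow> cut_minor D H \<and> \<not> (\<exists>J. odd_dijoin H J)" for H :: "('a, 'b) pre_digraph"
    \<comment> \<open>Contractions and arc deletions lower the number of arcs without adding
      vertices, and vertex deletions lower the number of vertices, so all three operations decrease
      this measure.\<close>
    define size where "size H = card (verts H) + card (arcs H)" for H :: "('a, 'b) pre_digraph"
    have "P D" using none cut_minor.refl by (auto simp: P_def)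
    define H where "H = arg_min size P"
    have PH: "P H" unfolding H_def using \<open>P D\<close> by (rule arg_min_natI[where P = P])
    have min: "\<not> P H'" if "size H' < size H" for H'
      using that arg_min_nat_le[of P H' size] unfolding H_def by (metis not_le)
    have cm: "cut_minor D H" and noJ: "\<And>J. \<not> odd_dijoin H J" using PH by (auto simp: P_def)
    interpret H: fin_digraph H using cut_minor_fin_digraph[OF cm assms] .
    have "minimal_no_odd_dijoin H"
    proof (unfold_locales)
      fix J show "\<not> odd_dijoin H J" using noJ .
    next
      fix e assume e: "e \<in> arcs H"
      have "size (contract H {e}) < size H"
      proof -
        have "card (verts (contract H {e})) \<le> card (verts H)" by (simp add: contract_def card_image_le)
        moreover have "card (arcs (contract H {e})) < card (arcs H)"
          unfolding contract_def using card_Diff1_less[OF H.finite_arcs e] by simp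
        ultimately show ?thesis by (simp add: size_def)
      qed
      moreover have "cut_minor D (contract H {e})" using cm e by (rule cut_minor.contract_arc)
      ultimately obtain J where J: "odd_dijoin (contract H {e}) J" using min by (auto simp: P_def)
      then have "J \<subseteq> arcs H" by (auto simp: odd_dijoin_def contract_def)
      moreover have "par J S" if "directed_bond H S" "e \<notin> S" for S
        using J H.directed_bond_contract_iff[OF e] that by (simp add: odd_dijoin_iff)
      ultimately show "\<exists>J\<subseteq>arcs H. \<forall>S. directed_bond H S \<longrightarrow> e \<notin> S \<longrightarrow> par J S" by blast
    next
      fix e show "\<not> deletable H e"
      proof
        assume e: "deletable H e"
        then have "e \<in> arcs H" by (simp add: deletable_def)
        then have "size (H.del_arc e) < size H" 
          using card_Diff1_less[OF H.finite_arcs] by (simp add: size_def)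
        moreover have "cut_minor D (H.del_arc e)" using cm e by (rule cut_minor.delete_arc)
        ultimately obtain J where "odd_dijoin (H.del_arc e) J" using min by (auto simp: P_def)
        then show False using H.odd_dijoin_del_arcD[OF e] noJ by blast
      qed
    next
      fix v show "\<not> isolated H v"
      proof
        assume v: "isolated H v"
        then have "v \<in> verts H" by (simp add: isolated_def)
        then have "card (verts (H.del_vert v)) < card (verts H)"
          using card_Diff1_less[OF H.finite_verts] by (simp add: H.verts_del_vert)
        moreover have "card (arcs (H.del_vert v)) \<le> card (arcs H)"
          unfolding H.arcs_del_vert by (intro card_mono) auto
        ultimately have "size (H.del_vert v) < size H" by (simp add: size_def)
        moreover have "cut_minor D (H.del_vert v)" using cm v by (rule cut_minor.delete_vert)
        ultimately obtain J where "odd_dijoin (H.del_vert v) J" using min by (auto simp: P_def)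
        then show False using H.odd_dijoin_del_vert_iff[OF v] noJ by blast
      qed
    qed
    then show False using minimal_no_odd_dijoin.odd_diamond_or_one_direction no cm by blast
  qed
qed

end
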